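(* Let $k$ be a positive integer. Then the domain $\mathbb{H}_{1/k} = \{(z_1,z_2)\in\mathbb{C}^2 : |z_1|^{1/k} < |z_2| < 1\}$ is a Lu Qi-Keng domain.
   Context: For a domain $\Omega\subset\mathbb{C}^n$, the Bergman space $A^2(\Omega)$ is the Hilbert space of holomorphic functions on $\Omega$ that are square-integrable with respect to Lebesgue measure $dV$. The Bergman kernel of $\Omega$ is the function $\mathbb{B}_\Omega:\Omega\times\Omega\to\mathbb{C}$, given by the Riesz representation theorem, such that $\overline{\mathbb{B}_\Omega(z,\cdot)}\in A^2(\Omega)$ for each $z\in\Omega$ and $f(z)=\int_\Omega \mathbb{B}_\Omega(z,w)f(w)\,dV(w)$ for all $f\in A^2(\Omega)$, $z\in\Omega$. A domain $\Omega$ is called Lu Qi-Keng if its Bergman kernel is zero-free, i.e. $\mathbb{B}_\Omega(z,w)\neq 0$ for all $z,w\in\Omega$. *)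

theory Defs
  imports "HOL-Analysis.Analysis"
begin

definition domain_Cn :: "(complex ^ 'n) set \<Rightarrow> bool" where
  "domain_Cn \<Omega> \<longleftrightarrow> open \<Omega> \<and> connected \<Omega> \<and> \<Omega> \<noteq> {}"

text \<open>Holomorphy in several variables: real Frechet differentiability with a complex-linear
  derivative.\<close>

definition holomorphic_Cn :: "(complex ^ 'n \<Rightarrow> complex) \<Rightarrow> (complex ^ 'n) set \<Rightarrow> bool" where
  "holomorphic_Cn f \<Omega> \<longleftrightarrow>
     (\<forall>z\<in>\<Omega>. \<exists>D. (f has_derivative D) (at z) \<and> (\<forall>c v. D (c *s v) = c * D v))"

text \<open>Members of the Bergman space are total functions whose values outside \<open>\<Omega>\<close> are
  irrelevant. Since \<open>\<Omega>\<close> is open and the functions are continuous on it, integrating over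
  \<open>lborel\<close> is the same as integrating over its completion.\<close>

definition bergman_space :: "(complex ^ 'n) set \<Rightarrow> (complex ^ 'n \<Rightarrow> complex) set" where
  "bergman_space \<Omega> =
     {f. holomorphic_Cn f \<Omega> \<and> set_integrable lborel \<Omega> (\<lambda>z. (norm (f z))\<^sup>2)}"

definition is_bergman_kernel ::
    "(complex ^ 'n) set \<Rightarrow> (complex ^ 'n \<Rightarrow> complex ^ 'n \<Rightarrow> complex) \<Rightarrow> bool" where
  "is_bergman_kernel \<Omega> K \<longleftrightarrow>
     (\<forall>z\<in>\<Omega>. (\<lambda>w. cnj (K z w)) \<in> bergman_space \<Omega>) \<and>
     (\<forall>f\<in>bergman_space \<Omega>. \<forall>z\<in>\<Omega>. f z = (LINT w:\<Omega>|lborel. K z w * f w))"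

text \<open>The kernel is a function on \<open>\<Omega> \<times> \<Omega>\<close>; extending it by zero makes
  the total function unique.\<close>

definition bergman_kernel ::
    "(complex ^ 'n) set \<Rightarrow> complex ^ 'n \<Rightarrow> complex ^ 'n \<Rightarrow> complex" where
  "bergman_kernel \<Omega> =
     (THE K. is_bergman_kernel \<Omega> K \<and> (\<forall>z w. z \<notin> \<Omega> \<or> w \<notin> \<Omega> \<longrightarrow> K z w = 0))"

definition lu_qi_keng :: "(complex ^ 'n) set \<Rightarrow> bool" where
  "lu_qi_keng \<Omega> \<longleftrightarrow> domain_Cn \<Omega> \<and> (\<forall>z\<in>\<Omega>. \<forall>w\<in>\<Omega>. bergman_kernel \<Omega> z w \<noteq> 0)"

definition hartogs_triangle :: "real \<Rightarrow> (complex ^ 2) set" where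
  "hartogs_triangle \<gamma> = {z. norm (z $ 1) powr \<gamma> < norm (z $ 2) \<and> norm (z $ 2) < 1}"

end

theory Submission imports Defs "HOL-Complex_Analysis.Conformal_Mappings" begin

text \<open>
  For integral \<open>k\<close> the domain is \<open>{|z1| < |z2|^k, 0 < |z2| < 1}\<close>, and
  \<open>(z1, z2) \<mapsto> (z1 / z2^k, z2)\<close> maps it biholomorphically onto the product of the disc and the
  punctured disc, with Jacobian \<open>z2^(-k)\<close>. Square integrable holomorphic functions extend over the
  puncture, so the product has the kernel of the bidisc, and the transformation rule predicts the
  kernel
  \<open>s^k / (pi^2 (s^k - t)^2 (1 - s)^2)\<close> with \<open>s = z2 cnj w2\<close> and \<open>t = z1 cnj w1\<close>.
  Its numerator vanishes only for \<open>s = 0\<close>, which is impossible on the domain; hence the kernel has no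
  zeros. Since the kernel is unique (\<open>bergman_kernel_eqI\<close>), what needs proof is that this
  explicit function is a Bergman kernel.

  The reproducing property (\<open>hartogs_kernel_reproducing\<close>) is checked directly by Fubini,
  which replaces a change of variables in two complex dimensions by the one-dimensional formula. For
  fixed \<open>w2\<close> the fibre is the disc of radius \<open>|w2|^k\<close>, and in \<open>w1\<close> the kernel is a multiple of the
  Bergman kernel of that disc (\<open>hartogs_kernel_fibre\<close>). Integrating over the fibre therefore evaluates
  \<open>f\<close> at the point \<open>(z1 w2^k / z2^k, w2)\<close>. What remains is an integral over the punctured disc of a
  holomorphic function of \<open>w2\<close> against the disc kernel; this function is square integrable by the
  mean value inequality on the fibres, so its singularity at the origin is removable
  (\<open>square_integrable_removable_singularity\<close>), and the disc formula applies a second time.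

  The disc formula (\<open>bergman_reproducing_disc\<close>) rests on the invariance of
  Lebesgue measure under rotations. Averaging the integrand over rotations turns, by Cauchy's formula
  for the derivative, the integral into that of a function of \<open>|w|^2\<close>, namely of
  \<open>(s g(z s))'\<close> at \<open>s = |w|^2 / R^2\<close>. The image of the area measure under \<open>s\<close> is uniform on \<open>[0, 1]\<close>, and the
  fundamental theorem of calculus gives \<open>g(z)\<close>.
\<close>

section \<open>Linear maps preserving Lebesgue measure\<close>

text \<open>The preimage of a box is the box with permuted sides, and boxes determine Lebesgue measure. The
  lemma transports integrals between different coordinate models of the same space.\<close>

lemma lborel_distr_basis_bij:
  fixes \<phi> :: "'a::euclidean_space \<Rightarrow> 'b::euclidean_space"
  assumes lin: "linear \<phi>" and bij: "bij_betw \<phi> Basis Basis"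
  shows "distr lborel borel \<phi> = lborel"
proof (rule sym, rule lborel_eqI)
  have meas [measurable]: "\<phi> \<in> borel_measurable borel"
    using lin by (intro borel_measurable_continuous_onI linear_continuous_on)
      (simp add: linear_conv_bounded_linear)
  have inner: "\<phi> x \<bullet> \<phi> b = x \<bullet> b" if b: "b \<in> Basis" for x b
  proof -
    have "\<phi> x = \<phi> (\<Sum>c\<in>Basis. (x \<bullet> c) *\<^sub>R c)"
      by (simp add: euclidean_representation)
    also have "\<dots> = (\<Sum>c\<in>Basis. (x \<bullet> c) *\<^sub>R \<phi> c)"
      by (simp add: linear_sum[OF lin] linear_scale[OF lin])
    finally have "\<phi> x \<bullet> \<phi> b = (\<Sum>c\<in>Basis. (x \<bullet> c) * (\<phi> c \<bullet> \<phi> b))"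
      by (simp add: inner_sum_left)
    also have "\<dots> = (\<Sum>c\<in>Basis. if c = b then x \<bullet> c else 0)"
    proof (rule sum.cong[OF refl])
      fix c :: 'a assume c: "c \<in> Basis"
      have "\<phi> c \<in> Basis" "\<phi> b \<in> Basis" "\<phi> c = \<phi> b \<longleftrightarrow> c = b"
        using bij b c by (auto simp: bij_betw_def inj_on_def)
      then show "(x \<bullet> c) * (\<phi> c \<bullet> \<phi> b) = (if c = b then x \<bullet> c else 0)"
        by (simp add: inner_Basis)
    qed
    finally show ?thesis using b by simp
  qed
  fix l u :: 'b assume le: "\<And>b. b \<in> Basis \<Longrightarrow> l \<bullet> b \<le> u \<bullet> b"
  define \<psi> where "\<psi> y = (\<Sum>b\<in>Basis. (y \<bullet> \<phi> b) *\<^sub>R b)" for y :: 'b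
  have psi: "\<psi> y \<bullet> b = y \<bullet> \<phi> b" if "b \<in> Basis" for y b
    using that by (simp add: \<psi>_def)
  have Basis_eq: "(Basis :: 'b set) = \<phi> ` Basis"
    using bij by (simp add: bij_betw_def)
  have pre: "\<phi> -` box l u = box (\<psi> l) (\<psi> u)"
    by (auto simp: mem_box psi inner Basis_eq)
  have "emeasure (distr lborel borel \<phi>) (box l u) = emeasure lborel (box (\<psi> l) (\<psi> u))"
    by (simp add: emeasure_distr pre)
  also have "\<dots> = (\<Prod>b\<in>Basis. (\<psi> u - \<psi> l) \<bullet> b)"
    using le bij by (intro emeasure_lborel_box) (auto simp: psi Basis_eq)
  also have "(\<Prod>b\<in>Basis. (\<psi> u - \<psi> l) \<bullet> b) = (\<Prod>b\<in>Basis. (u - l) \<bullet> \<phi> b)"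
    by (intro prod.cong) (auto simp: psi inner_diff_left)
  also have "\<dots> = (\<Prod>b\<in>Basis. (u - l) \<bullet> b)"
    by (rule prod.reindex_bij_betw[OF bij])
  finally show "emeasure (distr lborel borel \<phi>) (box l u) = (\<Prod>b\<in>Basis. (u - l) \<bullet> b)" .
qed simp

text \<open>Rotations are orthogonal maps, and orthogonal maps of \<open>real ^ 2\<close> preserve Lebesgue measure; the
  coordinate isometry between that space and the complex plane carries this over.\<close>

lemma lborel_distr_rotation:
  fixes c :: complex
  assumes c: "norm c = 1"
  shows "distr lborel borel ((*) c) = lborel"
proof (rule sym, rule lborel_eqI)
  define T :: "complex \<Rightarrow> real^2" where "T z = vector [Re z, Im z]" for z
  define S :: "real^2 \<Rightarrow> complex" where "S v = Complex (v $ 1) (v $ 2)" for v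
  have ST [simp]: "S (T z) = z" for z by (simp add: S_def T_def)
  have TS [simp]: "T (S v) = v" for v by (simp add: S_def T_def vec_eq_iff forall_2)
  have linS: "linear S"
    by (rule linearI) (simp_all add: S_def complex_eq_iff)
  have linT: "linear T"
    by (rule linearI) (simp_all add: T_def vec_eq_iff forall_2)
  have injS: "inj S" by (metis TS injI)
  have BS: "(Basis :: (real^2) set) = {axis 1 1, axis 2 1}"
    by (auto simp: Basis_vec_def UNIV_2)
  have "bij_betw S Basis Basis"
    unfolding bij_betw_def
  proof
    show "inj_on S Basis" using injS by (rule inj_on_subset) simp
    have "S (axis 1 1) = 1" "S (axis 2 1) = \<i>"
      by (simp_all add: S_def axis_def complex_eq_iff)
    then show "S ` Basis = Basis"
      by (simp add: BS Basis_complex_def)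
  qed
  then have dS: "distr lborel borel S = lborel"
    by (rule lborel_distr_basis_bij[OF linS])
  have [measurable]: "S \<in> borel_measurable borel"
    using linS by (intro borel_measurable_continuous_onI linear_continuous_on)
      (simp add: linear_conv_bounded_linear)
  have emS: "emeasure lborel A = emeasure lborel (S -` A)" if "A \<in> sets borel" for A
    using that by (subst dS[symmetric]) (simp add: emeasure_distr)
  define r where "r v = T (cnj c * S v)" for v
  have "orthogonal_transformation r"
    unfolding orthogonal_transformation
  proof
    show "linear r"
      by (rule linearI)
        (simp_all add: r_def linear_add[OF linS] linear_scale[OF linS] linear_add[OF linT]
           linear_scale[OF linT] algebra_simps)
    have "norm (T z) = norm z" for z
      by (simp add: T_def norm_vec_def L2_set_def sum_2 cmod_def)
    moreover have "norm (S v) = norm v" for v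
      by (metis TS calculation)
    ultimately show "\<forall>v. norm (r v) = norm v" using c by (simp add: r_def norm_mult)
  qed
  note orth = measure_orthogonal_image[OF this] measurable_orthogonal_image[OF this]
  have cc: "c * cnj c = 1" using c by (simp add: complex_norm_square[symmetric])
  fix l u :: complex assume le: "\<And>b. b \<in> Basis \<Longrightarrow> l \<bullet> b \<le> u \<bullet> b"
  have box: "box l u \<in> sets borel" by simp
  have "(*) c \<in> borel_measurable borel" by measurable
  from measurable_sets[OF this box] have pre: "(*) c -` box l u \<in> sets borel" by simp
  have eq: "S -` ((*) c -` box l u) = r ` (S -` box l u)"
  proof (intro equalityI subsetI)
    fix v assume "v \<in> S -` ((*) c -` box l u)"
    then have "c * S v \<in> box l u" by simp
    moreover have "v = r (T (c * S v))"
      using cc by (simp add: r_def mult.commute mult.left_commute flip: mult.assoc)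
    ultimately show "v \<in> r ` (S -` box l u)" by (metis ST image_eqI vimageI)
  next
    fix v assume "v \<in> r ` (S -` box l u)"
    then obtain v' where "v = r v'" "S v' \<in> box l u" by auto
    then show "v \<in> S -` ((*) c -` box l u)"
      using cc by (simp add: r_def flip: mult.assoc)
  qed
  have fin: "emeasure lborel (S -` box l u) < \<infinity>"
    using emS[OF box] emeasure_bounded_finite[of "box l u"] by (simp add: bounded_box)
  have sb: "S -` box l u \<in> sets borel" "S -` ((*) c -` box l u) \<in> sets borel"
    using measurable_sets[of S borel borel] box pre by auto
  have lm: "S -` box l u \<in> lmeasurable"
    using fin sb by (auto simp: fmeasurable_def)
  have "emeasure (distr lborel borel ((*) c)) (box l u) = emeasure lborel ((*) c -` box l u)"
    by (subst emeasure_distr) simp_all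
  also have "\<dots> = emeasure lborel (S -` ((*) c -` box l u))"
    by (rule emS[OF pre])
  also have "\<dots> = emeasure lebesgue (r ` (S -` box l u))"
    using sb eq by simp
  also have "\<dots> = emeasure lebesgue (S -` box l u)"
    using orth[OF lm] lm by (simp add: emeasure_eq_measure2)
  also have "\<dots> = emeasure lborel (box l u)"
    using emS[OF box] sb by simp
  also have "\<dots> = ennreal (\<Prod>b\<in>Basis. (u - l) \<bullet> b)"
    using le by (intro emeasure_lborel_box)
  finally show "emeasure (distr lborel borel ((*) c)) (box l u) = (\<Prod>b\<in>Basis. (u - l) \<bullet> b)" .
qed simp

text \<open>The preimage of a ray is a disc minus a smaller concentric disc, whose area is linear in the
  squared radius. This one-dimensional image measure replaces integration in polar coordinates.\<close>

lemma lborel_disc_distr_norm_square: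
  fixes R :: real
  assumes R: "R > 0"
  shows "distr (density lborel (indicator (ball (0::complex) R))) borel (\<lambda>w. (norm w)\<^sup>2 / R\<^sup>2) =
         density lborel (\<lambda>t. ennreal (pi * R\<^sup>2) * indicator {0..1} t)" (is "?M = ?N")
proof (rule measure_eqI_lessThan)
  have em: "emeasure ?M {x<..} = ennreal (pi * R\<^sup>2 * (if x < 0 then 1 else if x < 1 then 1 - x else 0))" for x
  proof -
    have [measurable]: "(\<lambda>w::complex. (norm w)\<^sup>2 / R\<^sup>2) \<in> borel_measurable borel" by measurable
    define A where "A = (\<lambda>w::complex. (norm w)\<^sup>2 / R\<^sup>2) -` {x<..}"
    have [measurable]: "A \<in> sets borel"
      unfolding A_def using measurable_sets[of "\<lambda>w::complex. (norm w)\<^sup>2 / R\<^sup>2" borel borel "{x<..}"] by simp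
    have "emeasure ?M {x<..} = emeasure (density lborel (indicator (ball (0::complex) R))) A"
      by (subst emeasure_distr) (simp_all add: A_def)
    also have "\<dots> = (\<integral>\<^sup>+w. indicator (ball 0 R) w * indicator A w \<partial>lborel)"
      by (rule emeasure_density) (use borel_measurable_indicator[of "ball 0 R" "lborel::complex measure"] in simp_all)
    also have "\<dots> = emeasure lborel (ball 0 R \<inter> A)"
      by (subst indicator_inter_arith[symmetric]) simp
    also have "\<dots> = ennreal (pi * R\<^sup>2 * (if x < 0 then 1 else if x < 1 then 1 - x else 0))"
    proof -
      consider "x < 0" | "0 \<le> x" "x < 1" | "1 \<le> x" by linarith
      then show ?thesis
      proof cases
        case 1
        then have "ball 0 R \<inter> A = ball 0 R"
          by (auto simp: A_def) (smt (verit) divide_nonneg_nonneg zero_le_power2)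
        then show ?thesis using 1 R by (simp add: emeasure_ball unit_ball_vol_2)
      next
        case 2
        have "ball 0 R \<inter> A = ball 0 R - cball 0 (R * sqrt x)"
        proof -
          have "(norm w)\<^sup>2 / R\<^sup>2 > x \<longleftrightarrow> norm w > R * sqrt x" for w :: complex
          proof -
            have "(norm w)\<^sup>2 / R\<^sup>2 > x \<longleftrightarrow> (R * sqrt x)\<^sup>2 < (norm w)\<^sup>2"
              using R 2 by (simp add: field_simps power_mult_distrib)
            also have "\<dots> \<longleftrightarrow> norm w > R * sqrt x"
              using R 2 by (auto intro: power_strict_mono power_less_imp_less_base)
            finally show ?thesis .
          qed
          then show ?thesis by (auto simp: A_def dist_norm)
        qed
        moreover have "cball 0 (R * sqrt x) \<subseteq> ball (0::complex) R"
          using R 2 by (auto simp: dist_norm) (smt (verit) mult_less_cancel_left2 real_sqrt_lt_1_iff)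
        ultimately have "emeasure lborel (ball 0 R \<inter> A) = emeasure lborel (ball (0::complex) R) - emeasure lborel (cball (0::complex) (R * sqrt x))"
          using emeasure_lborel_cball_finite[of "0::complex" "R * sqrt x"] by (simp add: emeasure_Diff)
        also have "\<dots> = ennreal (pi * R\<^sup>2) - ennreal (pi * (R * sqrt x)\<^sup>2)"
          using R 2 by (simp add: emeasure_ball emeasure_cball unit_ball_vol_2)
        also have "\<dots> = ennreal (pi * R\<^sup>2 - pi * (R * sqrt x)\<^sup>2)"
          by (rule ennreal_minus) simp
        also have "pi * R\<^sup>2 - pi * (R * sqrt x)\<^sup>2 = pi * R\<^sup>2 * (1 - x)"
          using 2 by (simp add: power_mult_distrib algebra_simps)
        finally show ?thesis using 2 by simp
      next
        case 3
        have "ball 0 R \<inter> A = {}"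
        proof -
          have "(norm w)\<^sup>2 / R\<^sup>2 < 1" if "norm w < R" for w :: complex
            using that R by (simp add: power_strict_mono)
          then show ?thesis using 3 by (fastforce simp: A_def dist_norm)
        qed
        then show ?thesis using 3 by simp
      qed
    qed
    finally show ?thesis .
  qed
  have en: "emeasure ?N {x<..} = ennreal (pi * R\<^sup>2 * (if x < 0 then 1 else if x < 1 then 1 - x else 0))" for x
  proof -
    have "emeasure ?N {x<..} = (\<integral>\<^sup>+t. ennreal (pi * R\<^sup>2) * indicator ({0..1} \<inter> {x<..}) t \<partial>lborel)"
      by (subst emeasure_density) (auto intro!: nn_integral_cong split: split_indicator)
    also have "\<dots> = ennreal (pi * R\<^sup>2) * emeasure lborel ({0..1} \<inter> {x<..})"
      by (simp add: nn_integral_cmult_indicator)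
    also have "{0..1} \<inter> {x<..} = (if x < 0 then {0..1} else if x < 1 then {x<..1} else {})" by auto
    also have "emeasure lborel \<dots> = ennreal (if x < 0 then 1 else if x < 1 then 1 - x else 0)"
      by simp
    finally show ?thesis by (subst ennreal_mult) auto
  qed
  show "emeasure ?M {x<..} = emeasure ?N {x<..}" for x by (simp only: em en)
  show "emeasure ?M {x<..} < \<infinity>" for x by (simp add: em)
qed simp_all

lemma lebesgue_integral_disc_radial:
  fixes h :: "real \<Rightarrow> complex"
  assumes R: "R > 0" and [measurable]: "h \<in> borel_measurable borel"
  shows "(LINT w:ball (0::complex) R|lborel. h ((norm w)\<^sup>2 / R\<^sup>2)) =
         of_real (pi * R\<^sup>2) * (LINT t:{0..1}|lborel. h t)"
proof -
  have "(LINT w:ball (0::complex) R|lborel. h ((norm w)\<^sup>2 / R\<^sup>2)) =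
        integral\<^sup>L (density lborel (\<lambda>w. ennreal (indicator (ball (0::complex) R) w))) (\<lambda>w. h ((norm w)\<^sup>2 / R\<^sup>2))"
    by (subst integral_density)
      (use borel_measurable_indicator[of "ball 0 R" "borel::complex measure"] in \<open>simp_all add: set_lebesgue_integral_def\<close>)
  also have "\<dots> = integral\<^sup>L (distr (density lborel (indicator (ball (0::complex) R))) borel (\<lambda>w. (norm w)\<^sup>2 / R\<^sup>2)) h"
    by (subst integral_distr) (simp_all add: ennreal_indicator)
  also have "\<dots> = integral\<^sup>L (density lborel (\<lambda>t. ennreal (pi * R\<^sup>2) * indicator {0..1} t)) h"
    by (simp only: lborel_disc_distr_norm_square[OF R])
  also have "(\<lambda>t. ennreal (pi * R\<^sup>2) * indicator {0..1} t) = (\<lambda>t. ennreal (pi * R\<^sup>2 * indicator {0..1::real} t))"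
    by (auto split: split_indicator)
  also have "integral\<^sup>L (density lborel \<dots>) h = (LINT t|lborel. (pi * R\<^sup>2 * indicator {0..1} t) *\<^sub>R h t)"
    by (subst integral_density) simp_all
  also have "\<dots> = (LINT t|lborel. of_real (pi * R\<^sup>2) * (indicator {0..1} t *\<^sub>R h t))"
    by (intro Bochner_Integration.integral_cong) (simp_all add: scaleR_conv_of_real)
  finally show ?thesis by (simp only: integral_mult_right_zero set_lebesgue_integral_def)
qed

section \<open>The reproducing formula on a disc\<close>

text \<open>Each rotation leaves the integral unchanged, so the average over all rotations does too, and
  Fubini moves the average under the integral sign.\<close>

lemma lebesgue_integral_rotation_average:
  fixes Q :: "complex \<Rightarrow> complex"
  assumes Q: "integrable lborel Q"
  shows "(LINT w|lborel. Q w) = (LINT w|lborel. (LINT t:{0..1}|lborel. Q (cis (2 * pi * t) * w)))"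
proof -
  have Qm [measurable]: "Q \<in> borel_measurable borel" using Q by auto
  have cis_meas [measurable]: "(\<lambda>t. cis (2 * pi * t)) \<in> borel_measurable borel"
    by (intro borel_measurable_continuous_onI continuous_intros)
  have rot_int: "integrable lborel (\<lambda>w. Q (cis a * w))" for a
    using Q lborel_distr_rotation[of "cis a"]
    by (intro integrable_distr[of "(*) (cis a)" lborel borel Q]) auto
  have rot: "(LINT w|lborel. q (cis a * w)) = (LINT w|lborel. q w)"
    if "q \<in> borel_measurable borel" for a and q :: "complex \<Rightarrow> 'b::{banach,second_countable_topology}"
  proof -
    have "(LINT w|lborel. q w) = (LINT w|distr lborel borel ((*) (cis a)). q w)"
      by (subst lborel_distr_rotation) auto
    also have "\<dots> = (LINT w|lborel. q (cis a * w))"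
      using that by (intro integral_distr) auto
    finally show ?thesis ..
  qed
  define F where "F = (\<lambda>(t, w). indicator {0..1::real} t *\<^sub>R Q (cis (2 * pi * t) * w))"
  have "integrable (lborel \<Otimes>\<^sub>M lborel) F"
  proof (rule lborel_pair.Fubini_integrable)
    show "F \<in> borel_measurable (lborel \<Otimes>\<^sub>M lborel)"
      unfolding F_def by measurable
    have "(LINT w|lborel. norm (F (t, w))) = indicator {0..1} t *\<^sub>R (LINT w|lborel. norm (Q w))" for t
      using rot[of "\<lambda>w. norm (Q w)" "2 * pi * t"] by (simp add: F_def)
    then show "integrable lborel (\<lambda>t. LINT w|lborel. norm (F (t, w)))"
      by simp
    show "AE t in lborel. integrable lborel (\<lambda>w. F (t, w))"
      using rot_int by (simp add: F_def)
  qed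
  moreover have inner: "(LINT w|lborel. F (t, w)) = indicator {0..1} t *\<^sub>R (LINT w|lborel. Q w)" for t
    using rot[of Q "2 * pi * t"] by (simp add: F_def)
  ultimately have "(LINT w|lborel. LINT t|lborel. F (t, w)) = (LINT t|lborel. LINT w|lborel. F (t, w))"
    by (intro lborel_pair.Fubini_integral) simp
  also have "\<dots> = (LINT t|lborel. indicator {0..1::real} t *\<^sub>R (LINT w|lborel. Q w))"
    by (simp only: inner)
  also have "\<dots> = (LINT w|lborel. Q w)"
    by simp
  finally show ?thesis by (simp add: F_def set_lebesgue_integral_def)
qed

text \<open>With \<open>a = z cnj w / R^2\<close>, the integrand on the unit circle is
  \<open>f(\<zeta>) \<zeta> / (\<zeta> - a)^2\<close> up to a constant, where \<open>f(\<zeta>) = \<zeta> g(\<zeta> w)\<close>: on the circle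
  \<open>cnj \<zeta> = 1 / \<zeta>\<close>. Cauchy's formula gives \<open>f'(a)\<close>, and \<open>a w = z s\<close> makes the result depend on \<open>w\<close>
  through its norm only.\<close>

lemma circle_average_bergman_kernel:
  fixes g :: "complex \<Rightarrow> complex" and R :: real
  assumes R: "R > 0" and holg: "g holomorphic_on ball 0 R"
    and z: "norm z < R" and w: "norm w < R"
  defines "s \<equiv> of_real ((norm w)\<^sup>2 / R\<^sup>2)"
  shows "(LINT t:{0..1}|lborel. g (cis (2 * pi * t) * w) * of_real R ^ 2 /
            (of_real R ^ 2 - z * cnj (cis (2 * pi * t) * w)) ^ 2) =
         (g (z * s) + z * s * deriv g (z * s)) / of_real R ^ 2"
proof -
  define a where "a = z * cnj w / of_real R ^ 2"
  have "norm z * norm w < R * R"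
    using z w R by (intro mult_strict_mono) auto
  then have a: "norm a < 1"
    using R by (simp add: a_def norm_mult norm_divide norm_power power2_eq_square)
  have aw: "a * w = z * s"
    by (simp add: a_def s_def complex_norm_square[symmetric] mult.assoc mult.commute[of "cnj w"])
  have ball: "\<zeta> * w \<in> ball 0 R" if "norm \<zeta> \<le> 1" for \<zeta>
    using that w by (simp add: norm_mult) (meson le_less_trans mult_left_le_one_le norm_ge_zero)
  define f where "f \<zeta> = \<zeta> * g (\<zeta> * w)" for \<zeta>
  have holf: "f holomorphic_on cball 0 1"
    unfolding f_def
    by (intro holomorphic_intros holomorphic_on_compose_gen[OF _ holg, unfolded o_def])
      (use ball in auto)
  then have contf: "continuous_on (cball 0 1) f" by (rule holomorphic_on_imp_continuous_on)
  have "a \<in> ball 0 1" using a by simp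
  note cauchy = Cauchy_derivative_integral_circlepath[OF contf holomorphic_on_subset[OF holf ball_subset_cball] this]
  have "(g has_field_derivative deriv g (a * w)) (at (a * w))"
    using ball[of a] a holg by (intro holomorphic_derivI[OF holg]) auto
  then have "(f has_field_derivative g (a * w) + a * w * deriv g (a * w)) (at a)"
    unfolding f_def by (auto intro!: derivative_eq_intros DERIV_chain2[of g])
  from DERIV_unique[OF this cauchy(2)]
  have eq: "g (z * s) + z * s * deriv g (z * s) =
     1 / (2 * of_real pi * \<i>) * contour_integral (circlepath 0 1) (\<lambda>u. f u / (u - a)\<^sup>2)"
    by (simp add: aw)
  define H where "H t = g (cis (2 * pi * t) * w) * of_real R ^ 2 /
            (of_real R ^ 2 - z * cnj (cis (2 * pi * t) * w)) ^ 2" for t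
  have H: "f \<zeta> / (\<zeta> - a)\<^sup>2 * (2 * of_real pi * \<i> * \<zeta>) = (2 * of_real pi * \<i> * of_real R ^ 2) * H t"
    if "\<zeta> = cis (2 * pi * t)" for \<zeta> t
  proof -
    have n: "norm \<zeta> = 1" "\<zeta> \<noteq> 0" using that by auto
    then have c: "\<zeta> * cnj \<zeta> = 1" by (simp add: complex_norm_square[symmetric])
    have inv: "cnj \<zeta> = 1 / \<zeta>" using n c by (simp add: field_simps)
    define d where "d = \<zeta> - a"
    have "d \<noteq> 0" using a n by (auto simp: d_def)
    moreover have eq: "of_real R ^ 2 - z * cnj (\<zeta> * w) = of_real R ^ 2 * cnj \<zeta> * d"
      using R c by (simp add: a_def d_def algebra_simps)
    ultimately have "g (\<zeta> * w) * \<zeta> ^ 2 / d\<^sup>2 = of_real R ^ 2 * H t"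
      using R n unfolding H_def that[symmetric] eq inv
      by (simp add: field_simps power2_eq_square)
    then have "(2 * of_real pi * \<i>) * (g (\<zeta> * w) * \<zeta> ^ 2 / (\<zeta> - a)\<^sup>2) = (2 * of_real pi * \<i>) * (of_real R ^ 2 * H t)"
      by (simp add: d_def)
    then show ?thesis by (simp add: f_def power2_eq_square mult_ac)
  qed
  have contH: "continuous_on {0..1} H"
  proof -
    have "continuous_on {0..1} (\<lambda>t. g (cis (2 * pi * t) * w))"
      by (rule continuous_on_compose2[OF holomorphic_on_imp_continuous_on[OF holg]])
        (use ball in \<open>auto intro!: continuous_intros\<close>)
    moreover have "of_real R ^ 2 - z * cnj (cis (2 * pi * t) * w) \<noteq> 0" for t
    proof
      assume "of_real R ^ 2 - z * cnj (cis (2 * pi * t) * w) = 0"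
      then have "of_real R ^ 2 = z * cnj (cis (2 * pi * t) * w)" by simp
      then have "norm (of_real R ^ 2 :: complex) = norm (z * cnj (cis (2 * pi * t) * w))" by (rule arg_cong)
      then show False
        using \<open>norm z * norm w < R * R\<close> by (simp add: norm_mult norm_power power2_eq_square)
    qed
    ultimately show ?thesis unfolding H_def by (intro continuous_intros) auto
  qed
  have "contour_integral (circlepath 0 1) (\<lambda>u. f u / (u - a)\<^sup>2) =
        integral {0..1} (\<lambda>t. (2 * of_real pi * \<i> * of_real R ^ 2) * H t)"
    unfolding contour_integral_integral vector_derivative_circlepath
    by (intro Henstock_Kurzweil_Integration.integral_cong, subst H[symmetric])
      (auto simp: circlepath cis_conv_exp mult_ac)
  also have "\<dots> = (2 * of_real pi * \<i> * of_real R ^ 2) * integral {0..1} H"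
    by simp
  also have "integral {0..1} H = (LINT t:{0..1}|lborel. H t)"
    by (rule set_borel_integral_eq_integral(2)[symmetric, OF borel_integrable_atLeastAtMost'[OF contH]])
  finally show ?thesis using eq R by (simp add: H_def)
qed

text \<open>For fixed \<open>z\<close> the kernel is bounded in \<open>w\<close>, so the formula makes sense for integrable \<open>g\<close>. It
  can thus be applied to the square of a square integrable function as well.\<close>

lemma bergman_reproducing_disc:
  fixes g :: "complex \<Rightarrow> complex" and R :: real
  assumes R: "R > 0" and holg: "g holomorphic_on ball 0 R"
    and intg: "set_integrable lborel (ball 0 R) g" and z: "norm z < R"
  shows "(LINT w:ball 0 R|lborel. g w * of_real R ^ 2 / (of_real R ^ 2 - z * cnj w) ^ 2) = of_real pi * g z"
proof -
  define k where "k w = of_real R ^ 2 / (of_real R ^ 2 - z * cnj w) ^ 2" for w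
  define Q where "Q w = indicator (ball 0 R) w *\<^sub>R (g w * k w)" for w
  have low: "R\<^sup>2 - norm z * R \<le> norm (of_real R ^ 2 - z * cnj w)" if "norm w < R" for w
  proof -
    have "R\<^sup>2 - norm z * R \<le> R\<^sup>2 - norm z * norm w"
      using that by (simp add: mult_left_mono)
    also have "\<dots> = norm (of_real R ^ 2 :: complex) - norm (z * cnj w)"
      by (simp add: norm_mult norm_power)
    also have "\<dots> \<le> norm (of_real R ^ 2 - z * cnj w)" by (rule norm_triangle_ineq2)
    finally show ?thesis .
  qed
  define m where "m = R\<^sup>2 - norm z * R"
  have m: "m > 0" using z R by (simp add: m_def power2_eq_square algebra_simps)
  have contk: "continuous_on (ball 0 R) k"
    unfolding k_def using low m by (intro continuous_intros) (fastforce simp: m_def)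
  have boundk: "norm (k w) \<le> R\<^sup>2 / m\<^sup>2" if "norm w < R" for w
    using low[OF that] m R
    by (auto simp: k_def norm_divide norm_power m_def intro!: divide_left_mono power_mono mult_pos_pos)
  have contg: "continuous_on (ball 0 R) g" by (rule holomorphic_on_imp_continuous_on[OF holg])
  have "integrable lborel Q"
  proof (rule Bochner_Integration.integrable_bound)
    show "integrable lborel (\<lambda>w. (R\<^sup>2 / m\<^sup>2) *\<^sub>R (indicator (ball 0 R) w *\<^sub>R g w))"
      using intg by (intro integrable_scaleR_right) (simp add: set_integrable_def)
    show "Q \<in> borel_measurable lborel"
      unfolding Q_def using contg contk
      by (simp add: borel_measurable_continuous_on_indicator continuous_on_mult)
    have "norm (Q w) \<le> norm ((R\<^sup>2 / m\<^sup>2) *\<^sub>R (indicator (ball 0 R) w *\<^sub>R g w))" for w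
      using boundk[of w] by (auto simp: Q_def norm_mult abs_mult split: split_indicator intro!: mult_right_mono)
        (metis mult.commute mult_left_mono norm_ge_zero times_divide_eq_left)
    then show "AE w in lborel. norm (Q w) \<le> norm ((R\<^sup>2 / m\<^sup>2) *\<^sub>R (indicator (ball 0 R) w *\<^sub>R g w))"
      by simp
  qed
  note avg = lebesgue_integral_rotation_average[OF this]
  define h where "h s = indicator {0..1::real} s *\<^sub>R
     ((g (z * of_real s) + z * of_real s * deriv g (z * of_real s)) / of_real R ^ 2)" for s
  have zs: "z * of_real s \<in> ball 0 R" if "s \<in> {0..1}" for s
  proof -
    have "norm z * s \<le> norm z" using that by (simp add: mult_left_le)
    then show ?thesis using z that by (simp add: norm_mult)
  qed
  have conth: "continuous_on {0..1} (\<lambda>s. g (z * of_real s) + z * of_real s * deriv g (z * of_real s))"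
    by (intro continuous_intros continuous_on_compose2[OF contg]
         continuous_on_compose2[OF holomorphic_on_imp_continuous_on[OF holomorphic_deriv[OF holg]]])
      (use zs in auto)
  have hm: "h \<in> borel_measurable borel"
    unfolding h_def using conth R
    by (intro borel_measurable_continuous_on_indicator continuous_on_divide conth continuous_on_const) auto
  have inner: "(LINT t:{0..1}|lborel. Q (cis (2 * pi * t) * w)) =
     indicator (ball 0 R) w *\<^sub>R h ((norm w)\<^sup>2 / R\<^sup>2)" for w
  proof (cases "norm w < R")
    case True
    then have "(norm w)\<^sup>2 / R\<^sup>2 \<in> {0..1}" using R by (simp add: power_mono)
    then show ?thesis
      using circle_average_bergman_kernel[OF R holg z True] True
      by (simp add: Q_def h_def k_def norm_mult)
  qed (simp add: Q_def norm_mult set_lebesgue_integral_def)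
  have "(LINT w:ball 0 R|lborel. g w * of_real R ^ 2 / (of_real R ^ 2 - z * cnj w) ^ 2) = (LINT w|lborel. Q w)"
    by (simp add: Q_def k_def set_lebesgue_integral_def)
  also have "\<dots> = (LINT w:ball (0::complex) R|lborel. h ((norm w)\<^sup>2 / R\<^sup>2))"
    by (simp only: avg inner) (simp only: set_lebesgue_integral_def)
  also have "\<dots> = of_real (pi * R\<^sup>2) * (LINT s:{0..1}|lborel. h s)"
    by (rule lebesgue_integral_disc_radial[OF R hm])
  also have "(LINT s:{0..1}|lborel. h s) = (LINT s|lborel. indicator {0..1} s *\<^sub>R
     ((g (z * of_real s) + z * of_real s * deriv g (z * of_real s)) / of_real R ^ 2))"
    unfolding set_lebesgue_integral_def h_def
    by (intro Bochner_Integration.integral_cong) (auto split: split_indicator)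
  also have "\<dots> = of_real 1 * g (z * of_real 1) / of_real R ^ 2 - of_real 0 * g (z * of_real 0) / of_real R ^ 2"
  proof (rule integral_FTC_atLeastAtMost)
    show "continuous_on {0..1} (\<lambda>s. (g (z * of_real s) + z * of_real s * deriv g (z * of_real s)) / of_real R ^ 2)"
      using R by (intro continuous_on_divide conth continuous_on_const) auto
    fix s :: real assume s: "0 \<le> s" "s \<le> 1"
    then have "(g has_field_derivative deriv g (z * of_real s)) (at (z * of_real s))"
      using zs[of s] by (intro holomorphic_derivI[OF holg]) auto
    then have "((\<lambda>x. x * g (z * x)) has_field_derivative
       g (z * of_real s) + z * of_real s * deriv g (z * of_real s)) (at (of_real s))"
      by (auto intro!: derivative_eq_intros DERIV_chain2[of g])
    then have "((\<lambda>x. x * g (z * x) / of_real R ^ 2) has_field_derivative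
       (g (z * of_real s) + z * of_real s * deriv g (z * of_real s)) / of_real R ^ 2) (at (of_real s))"
      by (rule DERIV_cdivide)
    then show "((\<lambda>x. of_real x * g (z * of_real x) / of_real R ^ 2) has_vector_derivative
       (g (z * of_real s) + z * of_real s * deriv g (z * of_real s)) / of_real R ^ 2) (at s within {0..1})"
      by (rule has_vector_derivative_real_field)
  qed simp
  finally show ?thesis using R by simp
qed

section \<open>Square integrable holomorphic functions near a puncture\<close>

lemma set_integrable_norm_square_imp_integrable:
  fixes g :: "'a::euclidean_space \<Rightarrow> complex"
  assumes "open S" "bounded S" and contg: "continuous_on S g"
    and int2: "set_integrable lborel S (\<lambda>x. (norm (g x))\<^sup>2)"
  shows "set_integrable lborel S g"
  unfolding set_integrable_def
proof (rule Bochner_Integration.integrable_bound)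
  have fin: "integrable lborel (indicator S :: 'a \<Rightarrow> real)"
    using assms(1,2) emeasure_bounded_finite[of S] by (simp add: integrable_indicator_iff)
  show "integrable lborel (\<lambda>x. indicator S x + indicator S x *\<^sub>R (norm (g x))\<^sup>2 :: real)"
    using fin int2 by (intro Bochner_Integration.integrable_add) (simp_all add: set_integrable_def)
  show "(\<lambda>x. indicator S x *\<^sub>R g x) \<in> borel_measurable lborel"
    using contg \<open>open S\<close> by (simp add: borel_measurable_continuous_on_indicator)
  have "t \<le> 1 + t\<^sup>2" for t :: real
    using sum_power2_ge_zero[of "t - 1/2" 0] by (simp add: power2_eq_square algebra_simps)
  then show "AE x in lborel. norm (indicator S x *\<^sub>R g x) \<le> norm (indicator S x + indicator S x *\<^sub>R (norm (g x))\<^sup>2 :: real)"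
    by (auto simp: indicator_def)
qed

text \<open>At the centre of a disc the reproducing formula is the mean value property; here it is applied to
  \<open>g\<^sup>2\<close>.\<close>

lemma norm_square_le_disc_integral:
  fixes g :: "complex \<Rightarrow> complex"
  assumes r: "r > 0" and sub: "ball c r \<subseteq> S" and S: "S \<in> sets borel"
    and hol: "g holomorphic_on ball c r"
    and int2: "set_integrable lborel S (\<lambda>w. (norm (g w))\<^sup>2)"
  shows "pi * r\<^sup>2 * (norm (g c))\<^sup>2 \<le> (LINT w:S|lborel. (norm (g w))\<^sup>2)"
proof -
  define g' where "g' w = (g (c + w))\<^sup>2" for w
  have hol': "g' holomorphic_on ball 0 r"
    unfolding g'_def
    by (intro holomorphic_intros holomorphic_on_compose_gen[OF _ hol, unfolded o_def])
      (auto simp: dist_norm)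
  have int2c: "set_integrable lborel (ball c r) (\<lambda>w. (norm (g w))\<^sup>2)"
    by (rule set_integrable_subset[OF int2]) (use sub in auto)
  define q where "q w = indicator (ball c r) w *\<^sub>R (norm (g w))\<^sup>2" for w
  have qint: "integrable lborel q" using int2c by (simp add: q_def[abs_def] set_integrable_def)
  have shift: "distr lborel borel ((+) c) = lborel" by (rule lborel_distr_plus)
  have qshift: "q (c + w) = indicator (ball 0 r) w *\<^sub>R norm (g' w)" for w
    by (auto simp: q_def g'_def norm_power indicator_def dist_norm)
  have qint': "integrable lborel (\<lambda>w. q (c + w))"
    using qint shift by (intro integrable_distr[of "(+) c" lborel borel q]) auto
  have "set_integrable lborel (ball 0 r) g'"
    unfolding set_integrable_def
  proof (rule Bochner_Integration.integrable_bound[OF qint'])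
    show "(\<lambda>w. indicator (ball 0 r) w *\<^sub>R g' w) \<in> borel_measurable lborel"
      using holomorphic_on_imp_continuous_on[OF hol']
      by (simp add: borel_measurable_continuous_on_indicator)
  qed (simp add: qshift)
  from bergman_reproducing_disc[OF r hol' this, of 0]
  have "(LINT w:ball 0 r|lborel. g' w * (1 / of_real r ^ 2)) = of_real pi * g' 0"
    using r by (simp add: power2_eq_square field_simps)
  then have "(LINT w:ball 0 r|lborel. g' w) = of_real (pi * r\<^sup>2) * g' 0"
    using r by (simp add: field_simps)
  then have "pi * r\<^sup>2 * (norm (g c))\<^sup>2 = norm (LINT w:ball 0 r|lborel. g' w)"
    by (simp add: norm_mult g'_def norm_power)
  also have "\<dots> \<le> (LINT w|lborel. norm (indicator (ball 0 r) w *\<^sub>R g' w))"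
    unfolding set_lebesgue_integral_def by (rule integral_norm_bound)
  also have "\<dots> = (LINT w|lborel. q (c + w))"
    by (simp add: qshift)
  also have "\<dots> = (LINT w|distr lborel borel ((+) c). q w)"
    using qint by (intro integral_distr[symmetric]) auto
  also have "\<dots> = (LINT w|lborel. q w)" by (simp only: shift)
  also have "\<dots> \<le> (LINT w:S|lborel. (norm (g w))\<^sup>2)"
    unfolding set_lebesgue_integral_def
    using int2 sub by (intro integral_mono qint) (auto simp: q_def set_integrable_def indicator_def)
  finally show ?thesis .
qed

text \<open>The disc of radius \<open>|w|\<close> about \<open>w\<close> misses the origin, so the mean value inequality bounds
  \<open>|w h(w)|^2\<close> by the integral of \<open>|h|^2\<close> over a punctured disc of radius \<open>2 |w|\<close>, which tends to
  \<open>0\<close>. That is Riemann's criterion. A mere bound on \<open>w h(w)\<close> would still allow a simple pole.\<close>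

lemma square_integrable_removable_singularity:
  fixes h :: "complex \<Rightarrow> complex"
  assumes R: "R > 0" and hol: "h holomorphic_on ball 0 R - {0}"
    and int2: "set_integrable lborel (ball 0 R - {0}) (\<lambda>w. (norm (h w))\<^sup>2)"
  shows "\<exists>H. H holomorphic_on ball 0 R \<and> (\<forall>w\<in>ball 0 R - {0}. H w = h w)"
proof -
  define D where "D = ball (0::complex) R - {0}"
  have [measurable]: "D \<in> sets borel" by (simp add: D_def)
  define q where "q w = indicator D w *\<^sub>R (norm (h w))\<^sup>2" for w
  have qint: "integrable lborel q" using int2 by (simp add: q_def[abs_def] set_integrable_def D_def)
  \<comment> \<open>Riemann's criterion, tested along sequences so that dominated convergence applies.\<close>
  have "((\<lambda>w. (w - 0) * h w) \<longlongrightarrow> 0) (at 0)"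
    unfolding tendsto_at_iff_sequentially o_def
  proof (intro allI impI)
    fix X :: "nat \<Rightarrow> complex"
    assume ne: "\<forall>i. X i \<in> UNIV - {0}" and X: "X \<longlonglongrightarrow> 0"
    have X2: "(\<lambda>n. 2 * norm (X n)) \<longlonglongrightarrow> 0"
      using tendsto_mult_left[OF tendsto_norm[OF X], of 2] by simp
    define \<Phi> where "\<Phi> n = (LINT w|lborel. indicator (ball 0 (2 * norm (X n))) w *\<^sub>R q w)" for n
    have "\<Phi> \<longlonglongrightarrow> (LINT w|(lborel :: complex measure). (0::real))"
      unfolding \<Phi>_def
    proof (rule integral_dominated_convergence[where w = "\<lambda>w. norm (q w)"])
      show "AE w in lborel. (\<lambda>n. indicator (ball 0 (2 * norm (X n))) w *\<^sub>R q w) \<longlonglongrightarrow> 0"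
      proof (rule AE_I2)
        fix w :: complex
        show "(\<lambda>n. indicator (ball 0 (2 * norm (X n))) w *\<^sub>R q w) \<longlonglongrightarrow> 0"
        proof (cases "w = 0")
          case False
          then have "\<forall>\<^sub>F n in sequentially. 2 * norm (X n) < norm w"
            by (intro order_tendstoD(2)[OF X2]) simp
          then show ?thesis
            by (intro tendsto_eventually, elim eventually_mono) (simp add: indicator_def)
        qed (simp add: q_def D_def)
      qed
      show "AE w in lborel. norm (indicator (ball 0 (2 * norm (X n))) w *\<^sub>R q w) \<le> norm (q w)" for n
        by (simp add: indicator_def)
      show "(\<lambda>w. indicator (ball 0 (2 * norm (X n))) w *\<^sub>R q w) \<in> borel_measurable lborel" for n
        using qint by (intro borel_measurable_scaleR borel_measurable_indicator) auto
    qed (use qint in auto)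
    then have Phi0: "(\<lambda>n. \<Phi> n / pi) \<longlonglongrightarrow> 0" by (auto intro: tendsto_eq_intros)
    have bound: "(norm (X n * h (X n)))\<^sup>2 \<le> \<Phi> n / pi" if n: "2 * norm (X n) < R" for n
    proof -
      define r where "r = norm (X n)"
      have r: "r > 0" using ne by (auto simp: r_def)
      have sub: "ball (X n) r \<subseteq> D \<inter> ball 0 (2 * r)"
      proof
        fix w assume "w \<in> ball (X n) r"
        then have "norm (X n - w) < r" by (simp add: dist_norm)
        then show "w \<in> D \<inter> ball 0 (2 * r)"
          using n norm_triangle_ineq4[of "X n" "X n - w"] by (auto simp: D_def r_def)
      qed
      have "pi * r\<^sup>2 * (norm (h (X n)))\<^sup>2 \<le> (LINT w:D \<inter> ball 0 (2 * r)|lborel. (norm (h w))\<^sup>2)"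
      proof (rule norm_square_le_disc_integral[OF r sub])
        show "h holomorphic_on ball (X n) r"
          using hol sub by (auto simp: D_def intro: holomorphic_on_subset)
        show "set_integrable lborel (D \<inter> ball 0 (2 * r)) (\<lambda>w. (norm (h w))\<^sup>2)"
          by (rule set_integrable_subset[OF int2]) (auto simp: D_def)
      qed auto
      also have "\<dots> = \<Phi> n"
        unfolding set_lebesgue_integral_def \<Phi>_def q_def r_def
        by (intro Bochner_Integration.integral_cong) (auto simp: indicator_def)
      finally show ?thesis
        by (simp add: r_def norm_mult power_mult_distrib field_simps)
    qed
    have "\<forall>\<^sub>F n in sequentially. 2 * norm (X n) < R"
      by (rule order_tendstoD(2)[OF X2 R])
    then have "(\<lambda>n. (norm (X n * h (X n)))\<^sup>2) \<longlonglongrightarrow> 0"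
      by (intro tendsto_sandwich[OF _ _ tendsto_const Phi0]) (auto elim: eventually_mono bound)
    then have "(\<lambda>n. sqrt ((norm (X n * h (X n)))\<^sup>2)) \<longlonglongrightarrow> sqrt 0"
      by (rule tendsto_real_sqrt)
    then show "(\<lambda>n. (X n - 0) * h (X n)) \<longlonglongrightarrow> 0"
      by (simp add: tendsto_norm_zero_iff)
  qed
  then show ?thesis
    using holomorphic_on_extend_lim[OF hol] R by (simp add: interior_open)
qed

lemma bergman_reproducing_punctured_disc:
  fixes h :: "complex \<Rightarrow> complex"
  assumes hol: "h holomorphic_on ball 0 1 - {0}"
    and int2: "set_integrable lborel (ball 0 1 - {0}) (\<lambda>w. (norm (h w))\<^sup>2)"
    and z: "norm z < 1" "z \<noteq> 0"
  shows "(LINT w:ball 0 1 - {0}|lborel. h w / (1 - z * cnj w)\<^sup>2) = of_real pi * h z"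
proof -
  obtain H where holH: "H holomorphic_on ball 0 1" and H: "\<And>w. w \<in> ball 0 1 - {0} \<Longrightarrow> H w = h w"
    using square_integrable_removable_singularity[OF _ hol int2] by auto
  have contH: "continuous_on (ball 0 1) H" using holH by (rule holomorphic_on_imp_continuous_on)
  have ae: "AE w in lborel. w \<noteq> (0::complex)" by (rule AE_lborel_singleton)
  have "set_integrable lborel (ball 0 1 - {0}) H"
  proof (rule set_integrable_norm_square_imp_integrable)
    show "continuous_on (ball 0 1 - {0}) H" using contH by (rule continuous_on_subset) auto
    have "(\<lambda>w. indicator (ball 0 1 - {0}) w *\<^sub>R (norm (H w))\<^sup>2) = (\<lambda>w. indicator (ball 0 1 - {0}) w *\<^sub>R (norm (h w))\<^sup>2)"
      using H by (auto simp: fun_eq_iff split: split_indicator)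
    then show "set_integrable lborel (ball 0 1 - {0}) (\<lambda>w. (norm (H w))\<^sup>2)"
      using int2 by (simp add: set_integrable_def)
  qed (auto intro: bounded_subset[OF bounded_ball])
  then have intH: "set_integrable lborel (ball 0 1) H"
    unfolding set_integrable_def
  proof (rule integrable_cong_AE_imp)
    show "AE w in lborel. indicator (ball 0 1 - {0}) w *\<^sub>R H w = indicator (ball 0 1) w *\<^sub>R H w"
      using ae by eventually_elim (simp add: indicator_def)
  qed (use contH in \<open>simp add: borel_measurable_continuous_on_indicator\<close>)
  have "1 - z * cnj w \<noteq> 0" if "norm w < 1" for w
  proof
    assume "1 - z * cnj w = 0"
    then have "norm (z * cnj w) = 1" by simp
    moreover have "norm z * norm w < 1 * 1" using z that by (intro mult_strict_mono) auto
    ultimately show False by (simp add: norm_mult)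
  qed
  then have cont: "continuous_on (ball 0 1) (\<lambda>w. H w / (1 - z * cnj w)\<^sup>2)"
    by (intro continuous_intros contH) auto
  have meq: "indicator (ball 0 1 - {0}) w *\<^sub>R (h w / (1 - z * cnj w)\<^sup>2) =
      indicator (ball 0 1 - {0}) w *\<^sub>R (H w / (1 - z * cnj w)\<^sup>2)" for w
    using H[of w] by (auto simp: indicator_def)
  have "(LINT w:ball 0 1 - {0}|lborel. h w / (1 - z * cnj w)\<^sup>2) =
        (LINT w:ball 0 1|lborel. H w / (1 - z * cnj w)\<^sup>2)"
    unfolding set_lebesgue_integral_def meq
  proof (rule integral_cong_AE)
    show "AE w in lborel. indicator (ball 0 1 - {0}) w *\<^sub>R (H w / (1 - z * cnj w)\<^sup>2) =
        indicator (ball 0 1) w *\<^sub>R (H w / (1 - z * cnj w)\<^sup>2)"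
      using ae by eventually_elim (simp add: indicator_def)
    show "(\<lambda>w. indicator (ball 0 1 - {0}) w *\<^sub>R (H w / (1 - z * cnj w)\<^sup>2)) \<in> borel_measurable lborel"
      using continuous_on_subset[OF cont] by (simp add: borel_measurable_continuous_on_indicator)
  qed (use cont in \<open>simp add: borel_measurable_continuous_on_indicator\<close>)
  also have "\<dots> = of_real pi * H z"
    using bergman_reproducing_disc[OF _ holH intH, of z] z by simp
  finally show ?thesis using H[of z] z by simp
qed

section \<open>Fibre coordinates on two-dimensional complex space\<close>

text \<open>The base coordinate \<open>z2\<close> comes first, so that Fubini integrates over \<open>z1\<close> in the fibre above a
  fixed \<open>z2\<close> first.\<close>

definition vec_of_base_fibre :: "complex \<times> complex \<Rightarrow> complex ^ 2" where
  "vec_of_base_fibre p = vector [snd p, fst p]"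

lemma vec_of_base_fibre_nth [simp]:
  "vec_of_base_fibre p $ 1 = snd p" "vec_of_base_fibre p $ 2 = fst p"
  by (simp_all add: vec_of_base_fibre_def)

lemma vec_of_base_fibre_eta: "vec_of_base_fibre (z $ 2, z $ 1) = z"
  by (simp add: vec_eq_iff forall_2)

lemma linear_vec_of_base_fibre: "linear vec_of_base_fibre"
  by (rule linearI) (simp_all add: vec_eq_iff forall_2)

lemma bounded_linear_vec_of_base_fibre: "bounded_linear vec_of_base_fibre"
  using linear_vec_of_base_fibre by (simp add: linear_conv_bounded_linear)

lemma measurable_vec_of_base_fibre [measurable]:
  "vec_of_base_fibre \<in> borel_measurable borel"
  by (intro borel_measurable_continuous_onI linear_continuous_on bounded_linear_vec_of_base_fibre)

lemma lborel_distr_vec_of_base_fibre: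
  "distr (lborel \<Otimes>\<^sub>M lborel) borel vec_of_base_fibre = lborel"
proof -
  have axis: "vec_of_base_fibre (u, 0) = axis 2 u" "vec_of_base_fibre (0, u) = axis 1 u" for u
    by (simp_all add: vec_eq_iff forall_2 axis_def)
  have "vec_of_base_fibre ` Basis = Basis"
    by (auto simp: Basis_prod_def Basis_vec_def image_Un image_image UNIV_2 axis)
  moreover have "inj vec_of_base_fibre"
    by (rule injI) (metis prod.collapse vec_of_base_fibre_nth)
  ultimately have "bij_betw vec_of_base_fibre Basis Basis"
    by (auto simp: bij_betw_def intro: inj_on_subset)
  from lborel_distr_basis_bij[OF linear_vec_of_base_fibre this] show ?thesis
    by (simp add: lborel_prod)
qed

lemma integrable_vec_of_base_fibre_iff:
  fixes g :: "complex ^ 2 \<Rightarrow> 'b::{banach, second_countable_topology}"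
  assumes "g \<in> borel_measurable borel"
  shows "integrable (lborel \<Otimes>\<^sub>M lborel) (\<lambda>p. g (vec_of_base_fibre p)) \<longleftrightarrow> integrable lborel g"
proof -
  have "vec_of_base_fibre \<in> borel_measurable (lborel \<Otimes>\<^sub>M lborel)" by (simp add: lborel_prod)
  from integrable_distr_eq[OF this assms] show ?thesis
    by (simp add: lborel_distr_vec_of_base_fibre)
qed

lemma integral_fibrewise:
  fixes g :: "complex ^ 2 \<Rightarrow> complex"
  assumes g: "integrable lborel g"
  shows "(LINT b|lborel. LINT a|lborel. g (vec_of_base_fibre (b, a))) = (LINT w|lborel. g w)"
proof -
  have [measurable]: "g \<in> borel_measurable borel" using g by auto
  have "(LINT w|lborel. g w) = (LINT p|(lborel \<Otimes>\<^sub>M lborel). g (vec_of_base_fibre p))"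
    by (subst lborel_distr_vec_of_base_fibre[symmetric])
       (intro integral_distr, simp_all add: lborel_prod)
  also have "\<dots> = (LINT b|lborel. LINT a|lborel. g (vec_of_base_fibre (b, a)))"
    using g by (intro lborel_pair.integral_fst'[symmetric]) (simp add: integrable_vec_of_base_fibre_iff)
  finally show ?thesis ..
qed

section \<open>Holomorphic functions of several variables\<close>

lemma holomorphic_Cn_imp_continuous_on:
  assumes "holomorphic_Cn f \<Omega>"
  shows "continuous_on \<Omega> f"
  using assms unfolding holomorphic_Cn_def
  by (meson continuous_at_imp_continuous_on has_derivative_continuous)

text \<open>The chain rule: a complex-linear derivative restricted to a complex tangent direction is
  multiplication by a number. It provides the holomorphic functions of one variable, on fibres and
  on graphs over the base, to which the disc formulas apply.\<close>

lemma holomorphic_Cn_compose_curve: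
  fixes f :: "complex ^ 2 \<Rightarrow> complex"
  assumes f: "holomorphic_Cn f \<Omega>" and S: "open S"
    and hol: "\<alpha> holomorphic_on S" "\<beta> holomorphic_on S"
    and sub: "\<And>x. x \<in> S \<Longrightarrow> vec_of_base_fibre (\<beta> x, \<alpha> x) \<in> \<Omega>"
  shows "(\<lambda>x. f (vec_of_base_fibre (\<beta> x, \<alpha> x))) holomorphic_on S"
proof -
  have "(\<lambda>x. f (vec_of_base_fibre (\<beta> x, \<alpha> x))) field_differentiable (at x)" if x: "x \<in> S" for x
  proof -
    have d: "(\<alpha> has_derivative (*) (deriv \<alpha> x)) (at x)" "(\<beta> has_derivative (*) (deriv \<beta> x)) (at x)"
      using holomorphic_derivI[OF hol(1) S x] holomorphic_derivI[OF hol(2) S x]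
      by (simp_all add: has_field_derivative_def)
    have \<gamma>: "((\<lambda>y. vec_of_base_fibre (\<beta> y, \<alpha> y)) has_derivative
        (\<lambda>t. vec_of_base_fibre (deriv \<beta> x * t, deriv \<alpha> x * t))) (at x)"
      by (intro bounded_linear.has_derivative[OF bounded_linear_vec_of_base_fibre]
           has_derivative_Pair d)
    obtain D where D: "(f has_derivative D) (at (vec_of_base_fibre (\<beta> x, \<alpha> x)))"
      and lin: "\<And>c v. D (c *s v) = c * D v"
      using f sub[OF x] by (auto simp: holomorphic_Cn_def)
    define v where "v = vec_of_base_fibre (deriv \<beta> x, deriv \<alpha> x)"
    have v: "vec_of_base_fibre (deriv \<beta> x * t, deriv \<alpha> x * t) = t *s v" for t
      by (simp add: v_def vec_eq_iff forall_2 mult.commute)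
    from has_derivative_compose[OF \<gamma> D]
    have "((\<lambda>y. f (vec_of_base_fibre (\<beta> y, \<alpha> y))) has_derivative (\<lambda>t. t * D v)) (at x)"
      by (simp only: v lin)
    moreover have "(\<lambda>t. t * D v) = (*) (D v)" by (simp add: fun_eq_iff mult.commute)
    ultimately have "((\<lambda>y. f (vec_of_base_fibre (\<beta> y, \<alpha> y))) has_derivative (*) (D v)) (at x)"
      by simp
    then show ?thesis
      unfolding field_differentiable_def has_field_derivative_def by blast
  qed
  then show ?thesis
    by (simp add: holomorphic_on_def field_differentiable_at_within)
qed

lemma holomorphic_Cn_const: "holomorphic_Cn (\<lambda>_. c) \<Omega>"
  unfolding holomorphic_Cn_def by (auto intro!: exI[of _ "\<lambda>_. 0"])

lemma holomorphic_Cn_nth: "holomorphic_Cn (\<lambda>z. z $ i) \<Omega>"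
  unfolding holomorphic_Cn_def
  by (auto intro!: exI[of _ "\<lambda>v. v $ i"] bounded_linear_imp_has_derivative bounded_linear_vec_nth)

lemma holomorphic_Cn_diff:
  assumes "holomorphic_Cn f \<Omega>" "holomorphic_Cn g \<Omega>"
  shows "holomorphic_Cn (\<lambda>z. f z - g z) \<Omega>"
  unfolding holomorphic_Cn_def
proof
  fix z assume z: "z \<in> \<Omega>"
  obtain D where D: "(f has_derivative D) (at z)" "\<And>c v. D (c *s v) = c * D v"
    using assms(1) z by (auto simp: holomorphic_Cn_def)
  obtain E where E: "(g has_derivative E) (at z)" "\<And>c v. E (c *s v) = c * E v"
    using assms(2) z by (auto simp: holomorphic_Cn_def)
  show "\<exists>D. ((\<lambda>z. f z - g z) has_derivative D) (at z) \<and> (\<forall>c v. D (c *s v) = c * D v)"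
    using has_derivative_diff[OF D(1) E(1)] D(2) E(2)
    by (intro exI[of _ "\<lambda>v. D v - E v"]) (simp add: right_diff_distrib)
qed

lemma holomorphic_Cn_mult:
  assumes "holomorphic_Cn f \<Omega>" "holomorphic_Cn g \<Omega>"
  shows "holomorphic_Cn (\<lambda>z. f z * g z) \<Omega>"
  unfolding holomorphic_Cn_def
proof
  fix z assume z: "z \<in> \<Omega>"
  obtain D where D: "(f has_derivative D) (at z)" "\<And>c v. D (c *s v) = c * D v"
    using assms(1) z by (auto simp: holomorphic_Cn_def)
  obtain E where E: "(g has_derivative E) (at z)" "\<And>c v. E (c *s v) = c * E v"
    using assms(2) z by (auto simp: holomorphic_Cn_def)
  show "\<exists>D. ((\<lambda>z. f z * g z) has_derivative D) (at z) \<and> (\<forall>c v. D (c *s v) = c * D v)"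
    using has_derivative_mult[OF D(1) E(1)] D(2) E(2)
    by (intro exI[of _ "\<lambda>v. f z * E v + D v * g z"]) (simp add: algebra_simps)
qed

lemma holomorphic_Cn_power:
  assumes "holomorphic_Cn f \<Omega>"
  shows "holomorphic_Cn (\<lambda>z. f z ^ n) \<Omega>"
  by (induction n) (simp_all add: holomorphic_Cn_const holomorphic_Cn_mult assms)

lemma holomorphic_Cn_inverse:
  assumes "holomorphic_Cn f \<Omega>" and nz: "\<And>z. z \<in> \<Omega> \<Longrightarrow> f z \<noteq> 0"
  shows "holomorphic_Cn (\<lambda>z. inverse (f z)) \<Omega>"
  unfolding holomorphic_Cn_def
proof
  fix z assume z: "z \<in> \<Omega>"
  obtain D where D: "(f has_derivative D) (at z)" "\<And>c v. D (c *s v) = c * D v"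
    using assms(1) z by (auto simp: holomorphic_Cn_def)
  show "\<exists>D. ((\<lambda>z. inverse (f z)) has_derivative D) (at z) \<and> (\<forall>c v. D (c *s v) = c * D v)"
    using Deriv.has_derivative_inverse[OF nz[OF z] D(1)] D(2)
    by (intro exI[of _ "\<lambda>v. - (inverse (f z) * D v * inverse (f z))"]) (simp add: algebra_simps)
qed

section \<open>Uniqueness of the Bergman kernel\<close>

lemma set_integrable_cnj_mult_of_bergman_space:
  assumes \<Omega>: "open \<Omega>" and "f \<in> bergman_space \<Omega>" "g \<in> bergman_space \<Omega>"
  shows "set_integrable lborel \<Omega> (\<lambda>w. cnj (g w) * f w)"
  unfolding set_integrable_def
proof (rule Bochner_Integration.integrable_bound)
  have f: "continuous_on \<Omega> f" "set_integrable lborel \<Omega> (\<lambda>w. (norm (f w))\<^sup>2)"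
   and g: "continuous_on \<Omega> g" "set_integrable lborel \<Omega> (\<lambda>w. (norm (g w))\<^sup>2)"
    using assms by (auto simp: bergman_space_def holomorphic_Cn_imp_continuous_on)
  show "integrable lborel (\<lambda>w. indicator \<Omega> w *\<^sub>R (norm (f w))\<^sup>2 + indicator \<Omega> w *\<^sub>R (norm (g w))\<^sup>2)"
    using f(2) g(2) by (intro Bochner_Integration.integrable_add) (simp_all add: set_integrable_def)
  have "(\<lambda>w. indicator \<Omega> w *\<^sub>R (cnj (g w) * f w)) \<in> borel_measurable borel"
    by (intro borel_measurable_continuous_on_indicator continuous_intros f(1) g(1)) (use \<Omega> in simp)
  then show "(\<lambda>w. indicator \<Omega> w *\<^sub>R (cnj (g w) * f w)) \<in> borel_measurable lborel"
    by simp
  have "x * y \<le> y\<^sup>2 + x\<^sup>2" if "x \<ge> 0" "y \<ge> 0" for x y :: real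
    using zero_le_power2[of "x - y"] mult_nonneg_nonneg[OF that] by (simp add: power2_eq_square algebra_simps)
  then show "AE w in lborel. norm (indicator \<Omega> w *\<^sub>R (cnj (g w) * f w))
      \<le> norm (indicator \<Omega> w *\<^sub>R (norm (f w))\<^sup>2 + indicator \<Omega> w *\<^sub>R (norm (g w))\<^sup>2)"
    by (auto simp: norm_mult split: split_indicator)
qed

lemma diff_mem_bergman_space:
  assumes \<Omega>: "open \<Omega>" and "f \<in> bergman_space \<Omega>" "g \<in> bergman_space \<Omega>"
  shows "(\<lambda>w. f w - g w) \<in> bergman_space \<Omega>"
proof -
  have f: "holomorphic_Cn f \<Omega>" "set_integrable lborel \<Omega> (\<lambda>w. (norm (f w))\<^sup>2)"
   and g: "holomorphic_Cn g \<Omega>" "set_integrable lborel \<Omega> (\<lambda>w. (norm (g w))\<^sup>2)"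
    using assms by (auto simp: bergman_space_def)
  note hol = holomorphic_Cn_diff[OF f(1) g(1)]
  have "set_integrable lborel \<Omega> (\<lambda>w. (norm (f w - g w))\<^sup>2)"
    unfolding set_integrable_def
  proof (rule Bochner_Integration.integrable_bound)
    show "integrable lborel (\<lambda>w. 2 * (indicator \<Omega> w *\<^sub>R (norm (f w))\<^sup>2) + 2 * (indicator \<Omega> w *\<^sub>R (norm (g w))\<^sup>2))"
      using f(2) g(2) by (intro Bochner_Integration.integrable_add integrable_mult_right) (simp_all add: set_integrable_def)
    have "(\<lambda>w. indicator \<Omega> w *\<^sub>R (norm (f w - g w))\<^sup>2) \<in> borel_measurable borel"
      by (intro borel_measurable_continuous_on_indicator continuous_on_power continuous_on_norm
            holomorphic_Cn_imp_continuous_on[OF hol]) (use \<Omega> in simp)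
    then show "(\<lambda>w. indicator \<Omega> w *\<^sub>R (norm (f w - g w))\<^sup>2) \<in> borel_measurable lborel"
      by simp
    have "(norm (x - y))\<^sup>2 \<le> 2 * (norm x)\<^sup>2 + 2 * (norm y)\<^sup>2" for x y :: complex
    proof -
      have "(norm (x - y))\<^sup>2 \<le> (norm x + norm y)\<^sup>2"
        by (intro power_mono norm_triangle_ineq4) simp
      also have "\<dots> \<le> 2 * (norm x)\<^sup>2 + 2 * (norm y)\<^sup>2"
        using zero_le_power2[of "norm x - norm y"] by (simp add: power2_eq_square algebra_simps)
      finally show ?thesis .
    qed
    then show "AE w in lborel. norm (indicator \<Omega> w *\<^sub>R (norm (f w - g w))\<^sup>2)
      \<le> norm (2 * (indicator \<Omega> w *\<^sub>R (norm (f w))\<^sup>2) + 2 * (indicator \<Omega> w *\<^sub>R (norm (g w))\<^sup>2))"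
      by (auto split: split_indicator)
  qed
  with hol show ?thesis by (simp add: bergman_space_def)
qed

lemma continuous_square_integral_zero_imp_zero:
  fixes g :: "'a::euclidean_space \<Rightarrow> complex"
  assumes \<Omega>: "open \<Omega>" and cont: "continuous_on \<Omega> g"
    and int: "set_integrable lborel \<Omega> (\<lambda>w. (norm (g w))\<^sup>2)"
    and zero: "(LINT w:\<Omega>|lborel. (norm (g w))\<^sup>2) = 0" and w: "w \<in> \<Omega>"
  shows "g w = 0"
proof (rule ccontr)
  assume "g w \<noteq> 0"
  define U where "U = {w \<in> \<Omega>. g w \<noteq> 0}"
  have "U = g -` (- {0}) \<inter> \<Omega>" by (auto simp: U_def)
  also have "open \<dots>" using cont \<Omega> by (intro continuous_on_open_vimage[THEN iffD1, rule_format]) auto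
  finally have U: "open U" "w \<in> U" using \<open>g w \<noteq> 0\<close> w by (auto simp: U_def)
  have "AE x in lborel. indicator \<Omega> x *\<^sub>R (norm (g x))\<^sup>2 = 0"
    using zero int unfolding set_lebesgue_integral_def set_integrable_def
    by (subst (asm) integral_nonneg_eq_0_iff_AE) auto
  then have "AE x in lborel. x \<notin> U"
    by eventually_elim (auto simp: U_def)
  then have "emeasure lborel U = 0"
    using U(1) by (subst (asm) AE_iff_measurable[of U]) auto
  moreover have "emeasure lborel U > 0"
    using open_not_negligible[OF U(1)] U calculation
    by (auto simp: negligible_iff_null_sets null_sets_def)
  ultimately show False by simp
qed

text \<open>For fixed \<open>z\<close>, the conjugate \<open>g\<close> of the difference of two kernels lies in the Bergman space.
  Reproducing \<open>g\<close> by both kernels and subtracting shows that its norm is zero.\<close>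

lemma is_bergman_kernel_unique:
  assumes \<Omega>: "open \<Omega>" and K: "is_bergman_kernel \<Omega> K" and L: "is_bergman_kernel \<Omega> L"
    and z: "z \<in> \<Omega>" and w: "w \<in> \<Omega>"
  shows "K z w = L z w"
proof -
  define g where "g w = cnj (K z w) - cnj (L z w)" for w
  have Kz: "(\<lambda>w. cnj (K z w)) \<in> bergman_space \<Omega>" and Lz: "(\<lambda>w. cnj (L z w)) \<in> bergman_space \<Omega>"
    using K L z by (auto simp: is_bergman_kernel_def)
  have g: "g \<in> bergman_space \<Omega>"
    unfolding g_def[abs_def] by (rule diff_mem_bergman_space[OF \<Omega> Kz Lz])
  have "g z = (LINT w:\<Omega>|lborel. K z w * g w)" "g z = (LINT w:\<Omega>|lborel. L z w * g w)"
    using K L g z by (auto simp: is_bergman_kernel_def)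
  moreover have "(LINT w:\<Omega>|lborel. K z w * g w - L z w * g w) =
      (LINT w:\<Omega>|lborel. K z w * g w) - (LINT w:\<Omega>|lborel. L z w * g w)"
    using set_integrable_cnj_mult_of_bergman_space[OF \<Omega> g Kz]
      set_integrable_cnj_mult_of_bergman_space[OF \<Omega> g Lz]
    by (intro set_integral_diff) simp_all
  moreover have "K z w * g w - L z w * g w = complex_of_real ((norm (g w))\<^sup>2)" for w
    by (simp only: complex_norm_square) (simp add: g_def algebra_simps)
  ultimately have "(LINT w:\<Omega>|lborel. complex_of_real ((norm (g w))\<^sup>2)) = 0" by simp
  then have "(LINT w:\<Omega>|lborel. (norm (g w))\<^sup>2) = 0"
    by (simp add: set_integral_complex_of_real del: of_real_power)
  then have "g w = 0"
    using g w by (intro continuous_square_integral_zero_imp_zero[OF \<Omega>])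
      (auto simp: bergman_space_def holomorphic_Cn_imp_continuous_on)
  then show ?thesis by (simp add: g_def)
qed

text \<open>The kernel is characterised as a total function that vanishes off the domain, so \<open>K\<close> is first
  truncated; truncation changes no value, derivative or integral that matters on the open domain.\<close>

lemma bergman_kernel_eqI:
  assumes \<Omega>: "open \<Omega>" and K: "is_bergman_kernel \<Omega> K" and z: "z \<in> \<Omega>" and w: "w \<in> \<Omega>"
  shows "bergman_kernel \<Omega> z w = K z w"
proof -
  let ?P = "\<lambda>K. is_bergman_kernel \<Omega> K \<and> (\<forall>z w. z \<notin> \<Omega> \<or> w \<notin> \<Omega> \<longrightarrow> K z w = 0)"
  define K0 where "K0 z w = (if z \<in> \<Omega> \<and> w \<in> \<Omega> then K z w else 0)" for z w
  have "is_bergman_kernel \<Omega> K0"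
    unfolding is_bergman_kernel_def
  proof (intro conjI ballI)
    fix z assume z: "z \<in> \<Omega>"
    have KB: "holomorphic_Cn (\<lambda>w. cnj (K z w)) \<Omega>" "set_integrable lborel \<Omega> (\<lambda>w. (norm (cnj (K z w)))\<^sup>2)"
      using K z by (auto simp: is_bergman_kernel_def bergman_space_def)
    have "holomorphic_Cn (\<lambda>w. cnj (K0 z w)) \<Omega>"
      unfolding holomorphic_Cn_def
    proof
      fix w assume w: "w \<in> \<Omega>"
      then obtain D where D: "((\<lambda>w. cnj (K z w)) has_derivative D) (at w)" "\<forall>c v. D (c *s v) = c * D v"
        using KB(1) by (auto simp: holomorphic_Cn_def)
      have "((\<lambda>w. cnj (K0 z w)) has_derivative D) (at w)"
        by (rule has_derivative_transform_within_open[OF D(1) \<Omega> w]) (simp add: K0_def z)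
      with D(2) show "\<exists>D. ((\<lambda>w. cnj (K0 z w)) has_derivative D) (at w) \<and> (\<forall>c v. D (c *s v) = c * D v)"
        by blast
    qed
    moreover have "set_integrable lborel \<Omega> (\<lambda>w. (norm (cnj (K0 z w)))\<^sup>2)"
    proof -
      have "(\<lambda>w. indicator \<Omega> w *\<^sub>R (norm (cnj (K0 z w)))\<^sup>2) = (\<lambda>w. indicator \<Omega> w *\<^sub>R (norm (cnj (K z w)))\<^sup>2)"
        using z by (auto simp: K0_def fun_eq_iff split: split_indicator)
      then show ?thesis using KB(2) by (simp add: set_integrable_def)
    qed
    ultimately show "(\<lambda>w. cnj (K0 z w)) \<in> bergman_space \<Omega>" by (simp add: bergman_space_def)
  next
    fix f z assume f: "f \<in> bergman_space \<Omega>" and z: "z \<in> \<Omega>"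
    have "(LINT w:\<Omega>|lborel. K0 z w * f w) = (LINT w:\<Omega>|lborel. K z w * f w)"
      unfolding set_lebesgue_integral_def
      using z by (intro Bochner_Integration.integral_cong) (auto simp: K0_def split: split_indicator)
    then show "f z = (LINT w:\<Omega>|lborel. K0 z w * f w)"
      using K f z by (simp add: is_bergman_kernel_def)
  qed
  then have P: "?P K0" by (auto simp: K0_def)
  have "bergman_kernel \<Omega> = K0"
    unfolding bergman_kernel_def
  proof (rule the_equality)
    show "?P K0" by (rule P)
  next
    fix L assume L: "?P L"
    show "L = K0"
    proof (intro ext)
      fix z w
      show "L z w = K0 z w"
      proof (cases "z \<in> \<Omega> \<and> w \<in> \<Omega>")
        case True
        then show ?thesis
          using is_bergman_kernel_unique[OF \<Omega> conjunct1[OF L] conjunct1[OF P]] by blast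
      next
        case False
        then show ?thesis using conjunct2[OF L] conjunct2[OF P] by metis
      qed
    qed
  qed
  then show ?thesis using z w by (simp add: K0_def)
qed

section \<open>Geometry of the generalised Hartogs triangle\<close>

lemma powr_inverse_less_iff:
  fixes x y :: real and k :: nat
  assumes "k > 0" "x \<ge> 0" "y \<ge> 0"
  shows "x powr (1 / real k) < y \<longleftrightarrow> x < y ^ k"
proof -
  have "(x powr (1 / real k)) ^ k = x"
  proof (cases "x = 0")
    case False
    then show ?thesis using assms by (simp add: powr_powr flip: powr_realpow)
  qed (use assms in simp)
  then show ?thesis
    using assms power_strict_mono[of "x powr (1 / real k)" y k]
      power_less_imp_less_base[of "x powr (1 / real k)" k y] by auto
qed

lemma mem_hartogs_triangle_iff:
  assumes "k > 0"
  shows "z \<in> hartogs_triangle (1 / real k) \<longleftrightarrow> norm (z $ 1) < norm (z $ 2) ^ k \<and> norm (z $ 2) < 1"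
  using powr_inverse_less_iff[OF assms, of "norm (z $ 1)" "norm (z $ 2)"]
  by (simp add: hartogs_triangle_def)

lemma hartogs_triangle_nonzero:
  assumes "k > 0" "z \<in> hartogs_triangle (1 / real k)"
  shows "z $ 2 \<noteq> 0"
  using assms by (auto simp: mem_hartogs_triangle_iff power_0_left)

lemma vec_of_base_fibre_mem_hartogs_triangle_iff:
  assumes "k > 0"
  shows "vec_of_base_fibre (b, a) \<in> hartogs_triangle (1 / real k) \<longleftrightarrow>
    b \<in> ball 0 1 - {0} \<and> a \<in> ball 0 (norm b ^ k)"
  using assms by (auto simp: mem_hartogs_triangle_iff power_0_left)

lemma open_hartogs_triangle:
  assumes "k > 0"
  shows "open (hartogs_triangle (1 / real k))"
proof -
  have "hartogs_triangle (1 / real k) =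
      {z. norm (z $ 1) < norm (z $ 2) ^ k} \<inter> {z. norm (z $ 2) < 1}"
    by (auto simp: mem_hartogs_triangle_iff[OF assms])
  also have "open \<dots>"
    by (intro open_Int open_Collect_less continuous_intros)
  finally show ?thesis .
qed

text \<open>Connectedness comes from the parametrisation \<open>(b, u) \<mapsto> (u b^k, b)\<close> by a product of a punctured
  disc and a disc.\<close>

lemma domain_Cn_hartogs_triangle:
  assumes k: "k > 0"
  shows "domain_Cn (hartogs_triangle (1 / real k))"
proof -
  let ?P = "(ball (0::complex) 1 - {0}) \<times> ball (0::complex) 1"
  let ?m = "\<lambda>p::complex \<times> complex. vec_of_base_fibre (fst p, snd p * fst p ^ k)"
  have eq: "hartogs_triangle (1 / real k) = ?m ` ?P"
  proof (intro equalityI subsetI)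
    fix z assume z: "z \<in> hartogs_triangle (1 / real k)"
    have z2: "z $ 2 \<noteq> 0" by (rule hartogs_triangle_nonzero[OF k z])
    then have "z = ?m (z $ 2, z $ 1 / z $ 2 ^ k)"
      by (simp add: vec_of_base_fibre_eta)
    moreover have "(z $ 2, z $ 1 / z $ 2 ^ k) \<in> ?P"
      using z z2 by (simp add: mem_hartogs_triangle_iff[OF k] norm_divide norm_power)
    ultimately show "z \<in> ?m ` ?P" by (rule image_eqI)
  next
    fix z assume "z \<in> ?m ` ?P"
    then show "z \<in> hartogs_triangle (1 / real k)"
      by (auto simp: mem_hartogs_triangle_iff[OF k] norm_mult norm_power)
  qed
  have "connected ?P"
    using connected_punctured_ball[of "0::complex" 1] by (intro connected_Times) auto
  moreover have "continuous_on ?P ?m"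
    by (intro linear_continuous_on_compose[OF _ linear_vec_of_base_fibre] continuous_intros)
  ultimately have "connected (hartogs_triangle (1 / real k))"
    unfolding eq by (rule connected_continuous_image[rotated])
  moreover have "?m (1/2, 0) \<in> hartogs_triangle (1 / real k)"
    by (simp add: mem_hartogs_triangle_iff[OF k])
  ultimately show ?thesis
    using open_hartogs_triangle[OF k] by (auto simp: domain_Cn_def)
qed

section \<open>The explicit kernel\<close>

text \<open>The kernel of the bidisc pulled back along \<open>(z1, z2) \<mapsto> (z1 / z2^k, z2)\<close>, multiplied by the Jacobian at
  \<open>z\<close> and the conjugate Jacobian at \<open>w\<close>, and cleared of inner fractions.\<close>

definition hartogs_kernel :: "nat \<Rightarrow> complex ^ 2 \<Rightarrow> complex ^ 2 \<Rightarrow> complex" where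
  "hartogs_kernel k z w =
     (z $ 2 * cnj (w $ 2)) ^ k /
     (of_real pi ^ 2 * ((z $ 2 * cnj (w $ 2)) ^ k - z $ 1 * cnj (w $ 1)) ^ 2 * (1 - z $ 2 * cnj (w $ 2)) ^ 2)"

text \<open>For fixed \<open>z\<close> the left sides are positive and depend on \<open>w\<close> at most through \<open>|w2|^k\<close>. Hence the
  kernel has no poles in the domain and grows at most like \<open>|w2|^(-k)\<close> as \<open>w2\<close> tends to \<open>0\<close>.\<close>

lemma hartogs_kernel_denominators:
  assumes k: "k > 0" and z: "z \<in> hartogs_triangle (1 / real k)" and w: "w \<in> hartogs_triangle (1 / real k)"
  shows "norm (w $ 2) ^ k * (norm (z $ 2) ^ k - norm (z $ 1)) \<le> norm ((z $ 2 * cnj (w $ 2)) ^ k - z $ 1 * cnj (w $ 1))"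
    and "1 - norm (z $ 2) \<le> norm (1 - z $ 2 * cnj (w $ 2))"
proof -
  have zb: "norm (z $ 1) < norm (z $ 2) ^ k" "norm (z $ 2) < 1"
    and wb: "norm (w $ 1) < norm (w $ 2) ^ k" "norm (w $ 2) < 1"
    using z w by (auto simp: mem_hartogs_triangle_iff[OF k])
  have "norm (z $ 1) * norm (w $ 1) \<le> norm (z $ 1) * norm (w $ 2) ^ k"
    using wb by (intro mult_left_mono) auto
  then have "norm (w $ 2) ^ k * (norm (z $ 2) ^ k - norm (z $ 1)) \<le>
        norm ((z $ 2 * cnj (w $ 2)) ^ k) - norm (z $ 1 * cnj (w $ 1))"
    by (simp add: norm_mult norm_power power_mult_distrib algebra_simps)
  also have "\<dots> \<le> norm ((z $ 2 * cnj (w $ 2)) ^ k - z $ 1 * cnj (w $ 1))"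
    by (rule norm_triangle_ineq2)
  finally show "norm (w $ 2) ^ k * (norm (z $ 2) ^ k - norm (z $ 1)) \<le> norm ((z $ 2 * cnj (w $ 2)) ^ k - z $ 1 * cnj (w $ 1))" .
  have "1 - norm (z $ 2) \<le> norm (1::complex) - norm (z $ 2 * cnj (w $ 2))"
    using wb by (simp add: norm_mult mult_left_le)
  also have "\<dots> \<le> norm (1 - z $ 2 * cnj (w $ 2))" by (rule norm_triangle_ineq2)
  finally show "1 - norm (z $ 2) \<le> norm (1 - z $ 2 * cnj (w $ 2))" .
qed

lemma hartogs_kernel_denominators_nonzero:
  assumes k: "k > 0" and z: "z \<in> hartogs_triangle (1 / real k)" and w: "w \<in> hartogs_triangle (1 / real k)"
  shows "(z $ 2 * cnj (w $ 2)) ^ k - z $ 1 * cnj (w $ 1) \<noteq> 0" "1 - z $ 2 * cnj (w $ 2) \<noteq> 0"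
proof -
  have "0 < norm (w $ 2) ^ k * (norm (z $ 2) ^ k - norm (z $ 1))"
    using z hartogs_triangle_nonzero[OF k w] by (simp add: mem_hartogs_triangle_iff[OF k])
  then show "(z $ 2 * cnj (w $ 2)) ^ k - z $ 1 * cnj (w $ 1) \<noteq> 0"
    using hartogs_kernel_denominators(1)[OF assms] by auto
  show "1 - z $ 2 * cnj (w $ 2) \<noteq> 0"
    using hartogs_kernel_denominators(2)[OF assms] z by (auto simp: mem_hartogs_triangle_iff[OF k])
qed

lemma hartogs_kernel_nonzero:
  assumes k: "k > 0" and z: "z \<in> hartogs_triangle (1 / real k)" and w: "w \<in> hartogs_triangle (1 / real k)"
  shows "hartogs_kernel k z w \<noteq> 0"
  using hartogs_kernel_denominators_nonzero[OF assms] hartogs_triangle_nonzero[OF k z]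
    hartogs_triangle_nonzero[OF k w]
  by (simp add: hartogs_kernel_def)

lemma holomorphic_Cn_cnj_hartogs_kernel:
  assumes k: "k > 0" and z: "z \<in> hartogs_triangle (1 / real k)"
  shows "holomorphic_Cn (\<lambda>w. cnj (hartogs_kernel k z w)) (hartogs_triangle (1 / real k))"
proof -
  have eq: "cnj (hartogs_kernel k z w) = (cnj (z $ 2) * w $ 2) ^ k * inverse
     (of_real pi ^ 2 * ((cnj (z $ 2) * w $ 2) ^ k - cnj (z $ 1) * w $ 1) ^ 2 * (1 - cnj (z $ 2) * w $ 2) ^ 2)" for w
    by (simp add: hartogs_kernel_def divide_inverse)
  have "(cnj (z $ 2) * w $ 2) ^ k - cnj (z $ 1) * w $ 1 \<noteq> 0 \<and> 1 - cnj (z $ 2) * w $ 2 \<noteq> 0"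
    if w: "w \<in> hartogs_triangle (1 / real k)" for w
    using hartogs_kernel_denominators_nonzero[OF k w z] by (simp add: mult.commute)
  then show ?thesis
    unfolding eq
    by (intro holomorphic_Cn_mult holomorphic_Cn_inverse holomorphic_Cn_power holomorphic_Cn_diff
         holomorphic_Cn_const holomorphic_Cn_nth) auto
qed

text \<open>The fibre over \<open>b\<close> is a disc of area \<open>pi |b|^(2 k)\<close>, which exactly cancels the singularity.\<close>

lemma set_integrable_hartogs_triangle_inverse_power:
  assumes k: "k > 0"
  shows "set_integrable lborel (hartogs_triangle (1 / real k)) (\<lambda>w. 1 / norm (w $ 2) ^ (2 * k))"
proof -
  let ?\<Omega> = "hartogs_triangle (1 / real k)"
  let ?D = "ball (0::complex) 1 - {0}"
  define g where "g w = indicator ?\<Omega> w *\<^sub>R (1 / norm (w $ 2) ^ (2 * k))" for w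
  have gm: "g \<in> borel_measurable borel"
    unfolding g_def using open_hartogs_triangle[OF k] hartogs_triangle_nonzero[OF k]
    by (intro borel_measurable_continuous_on_indicator continuous_intros) auto
  have gJ: "g (vec_of_base_fibre (b, a)) = (indicator ?D b / norm b ^ (2 * k)) * indicator (ball 0 (norm b ^ k)) a" for b a
    by (simp add: g_def indicator_def vec_of_base_fibre_mem_hartogs_triangle_iff[OF k])
  have slice: "integrable lborel (\<lambda>a. g (vec_of_base_fibre (b, a)))" for b
    using emeasure_bounded_finite[of "ball (0::complex) (norm b ^ k)"]
    by (simp add: gJ integrable_indicator_iff)
  have val: "(LINT a|lborel. norm (g (vec_of_base_fibre (b, a)))) = pi * indicator ?D b" for b
  proof -
    have "(LINT a|lborel. norm (g (vec_of_base_fibre (b, a)))) =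
        (indicator ?D b / norm b ^ (2 * k)) * measure lborel (ball (0::complex) (norm b ^ k))"
      by (simp add: gJ abs_mult)
    also have "\<dots> = pi * indicator ?D b"
      by (simp add: content_ball unit_ball_vol_2 indicator_def power_mult[symmetric] mult.commute)
    finally show ?thesis .
  qed
  have "integrable (lborel \<Otimes>\<^sub>M lborel) (\<lambda>p. g (vec_of_base_fibre p))"
  proof (rule lborel_pair.Fubini_integrable)
    show "(\<lambda>p. g (vec_of_base_fibre p)) \<in> borel_measurable (lborel \<Otimes>\<^sub>M lborel)"
      using measurable_compose[OF measurable_vec_of_base_fibre gm] by (simp add: lborel_prod)
    have "emeasure lborel ?D < \<infinity>"
      by (rule emeasure_bounded_finite) (auto intro: bounded_subset[OF bounded_ball])
    then show "integrable lborel (\<lambda>b. LINT a|lborel. norm (g (vec_of_base_fibre (b, a))))"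
      unfolding val by (intro integrable_mult_right) (simp add: integrable_indicator_iff)
  qed (simp add: slice)
  then have "integrable lborel g"
    using gm by (simp add: integrable_vec_of_base_fibre_iff)
  then show ?thesis by (simp add: set_integrable_def g_def[abs_def])
qed

lemma cnj_hartogs_kernel_mem_bergman_space:
  assumes k: "k > 0" and z: "z \<in> hartogs_triangle (1 / real k)"
  shows "(\<lambda>w. cnj (hartogs_kernel k z w)) \<in> bergman_space (hartogs_triangle (1 / real k))"
proof -
  let ?\<Omega> = "hartogs_triangle (1 / real k)"
  have zb: "norm (z $ 1) < norm (z $ 2) ^ k" "norm (z $ 2) < 1"
    using z by (auto simp: mem_hartogs_triangle_iff[OF k])
  define d where "d = norm (z $ 2) ^ k - norm (z $ 1)"
  define e where "e = 1 - norm (z $ 2)"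
  have de: "d > 0" "e > 0" using zb by (auto simp: d_def e_def)
  define C where "C = 1 / (pi ^ 2 * d ^ 2 * e ^ 2)"
  have bound: "(norm (hartogs_kernel k z w))\<^sup>2 \<le> C\<^sup>2 * (1 / norm (w $ 2) ^ (2 * k))" if w: "w \<in> ?\<Omega>" for w
  proof -
    have w2: "norm (w $ 2) > 0" using hartogs_triangle_nonzero[OF k w] by simp
    note low = hartogs_kernel_denominators[OF k z w, folded d_def e_def]
    have "norm (z $ 2) ^ k \<le> 1" using zb by (simp add: power_le_one)
    then have num: "norm ((z $ 2 * cnj (w $ 2)) ^ k) \<le> norm (w $ 2) ^ k"
      by (simp add: norm_mult norm_power power_mult_distrib mult_left_le_one_le)
    have "norm (hartogs_kernel k z w) \<le> norm (w $ 2) ^ k / (pi ^ 2 * (norm (w $ 2) ^ k * d) ^ 2 * e ^ 2)"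
      unfolding hartogs_kernel_def norm_divide norm_mult[of "_ * _"] norm_mult[of "_ ^ 2"] norm_power[of _ 2]
        using num low de w2
        by (intro frac_le mult_mono power_mono mult_nonneg_nonneg) auto
    also have "\<dots> = C / norm (w $ 2) ^ k"
      using w2 de by (simp add: C_def field_simps power2_eq_square)
    finally have "(norm (hartogs_kernel k z w))\<^sup>2 \<le> (C / norm (w $ 2) ^ k)\<^sup>2"
      by (rule power_mono) simp
    then show ?thesis by (simp add: power_divide mult.commute flip: power_mult)
  qed
  note hol = holomorphic_Cn_cnj_hartogs_kernel[OF k z]
  have "continuous_on ?\<Omega> (\<lambda>w. (norm (cnj (hartogs_kernel k z w)))\<^sup>2)"
    by (intro continuous_intros holomorphic_Cn_imp_continuous_on[OF hol])
  then have meas: "(\<lambda>w. indicator ?\<Omega> w *\<^sub>R (norm (cnj (hartogs_kernel k z w)))\<^sup>2) \<in> borel_measurable borel"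
    using open_hartogs_triangle[OF k] by (intro borel_measurable_continuous_on_indicator) auto
  have "set_integrable lborel ?\<Omega> (\<lambda>w. (norm (cnj (hartogs_kernel k z w)))\<^sup>2)"
    unfolding set_integrable_def
  proof (rule Bochner_Integration.integrable_bound)
    show "integrable lborel (\<lambda>w. C\<^sup>2 * (indicator ?\<Omega> w *\<^sub>R (1 / norm (w $ 2) ^ (2 * k))))"
      using set_integrable_hartogs_triangle_inverse_power[OF k]
      by (intro integrable_mult_right) (simp add: set_integrable_def)
    show "AE w in lborel. norm (indicator ?\<Omega> w *\<^sub>R (norm (cnj (hartogs_kernel k z w)))\<^sup>2)
        \<le> norm (C\<^sup>2 * (indicator ?\<Omega> w *\<^sub>R (1 / norm (w $ 2) ^ (2 * k))))"
      using bound by (auto split: split_indicator simp: abs_mult)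
  qed (use meas in simp)
  then show ?thesis using hol by (simp add: bergman_space_def)
qed

section \<open>The reproducing property\<close>

text \<open>Up to a factor that is independent of \<open>a\<close>, the kernel restricted to the fibre over \<open>b\<close> is the
  reproducing kernel of the fibre, a disc of radius \<open>|b|^k\<close>. The evaluation point \<open>\<zeta>\<close> is the point of
  this fibre with the same normalised coordinate \<open>z1 / z2^k\<close> as \<open>z\<close>.\<close>

lemma hartogs_kernel_fibre:
  assumes k: "k > 0" and z: "z \<in> hartogs_triangle (1 / real k)"
    and w: "vec_of_base_fibre (b, a) \<in> hartogs_triangle (1 / real k)"
  defines "\<zeta> \<equiv> z $ 1 / z $ 2 ^ k * b ^ k"
  shows "hartogs_kernel k z (vec_of_base_fibre (b, a)) =
    (b / z $ 2) ^ k / (1 - z $ 2 * cnj b)\<^sup>2 / of_real pi ^ 2 *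
      (of_real (norm b ^ k) ^ 2 / (of_real (norm b ^ k) ^ 2 - \<zeta> * cnj a)\<^sup>2)"
proof -
  define B where "B = b ^ k"
  define Z where "Z = z $ 2 ^ k"
  have nz: "B \<noteq> 0" "Z \<noteq> 0"
    using hartogs_triangle_nonzero[OF k z] hartogs_triangle_nonzero[OF k w] by (auto simp: B_def Z_def)
  have d: "Z * cnj B - z $ 1 * cnj a \<noteq> 0" "1 - z $ 2 * cnj b \<noteq> 0"
    using hartogs_kernel_denominators_nonzero[OF k z w]
    by (auto simp: B_def Z_def power_mult_distrib)
  define E where "E = Z * cnj B - z $ 1 * cnj a"
  have R2: "of_real (norm b ^ k) ^ 2 = B * cnj B"
    by (simp add: B_def complex_norm_square[symmetric] norm_power del: complex_cnj_power)
  have "of_real (norm b ^ k) ^ 2 - \<zeta> * cnj a = B / Z * E"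
    unfolding R2 E_def using nz by (simp add: \<zeta>_def B_def[symmetric] Z_def[symmetric] field_simps)
  then have "B / Z * (of_real (norm b ^ k) ^ 2 / (of_real (norm b ^ k) ^ 2 - \<zeta> * cnj a)\<^sup>2)
      = Z * cnj B / E\<^sup>2"
    unfolding R2 using nz d(1) by (simp add: E_def[symmetric] power2_eq_square)
  moreover have "hartogs_kernel k z (vec_of_base_fibre (b, a)) =
      Z * cnj B / E\<^sup>2 / (1 - z $ 2 * cnj b)\<^sup>2 / of_real pi ^ 2"
    by (simp add: hartogs_kernel_def E_def B_def Z_def power_mult_distrib)
  ultimately have "hartogs_kernel k z (vec_of_base_fibre (b, a)) =
      B / Z * (of_real (norm b ^ k) ^ 2 / (of_real (norm b ^ k) ^ 2 - \<zeta> * cnj a)\<^sup>2) /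
        (1 - z $ 2 * cnj b)\<^sup>2 / of_real pi ^ 2"
    by (simp only:)
  then show ?thesis
    by (simp add: power_divide B_def Z_def)
qed

lemma bergman_space_hartogs_triangle_integrable:
  fixes f :: "complex ^ 2 \<Rightarrow> complex"
  assumes k: "k > 0" and f: "f \<in> bergman_space (hartogs_triangle (1 / real k))"
  defines "G \<equiv> (\<lambda>b. LINT a:ball 0 (norm b ^ k)|lborel. indicator (ball 0 1 - {0}) b *\<^sub>R (norm (f (vec_of_base_fibre (b, a))))\<^sup>2)"
  shows "integrable lborel G"
    and "AE b in lborel. b \<in> ball 0 1 - {0} \<longrightarrow>
      set_integrable lborel (ball 0 (norm b ^ k)) (\<lambda>a. (norm (f (vec_of_base_fibre (b, a))))\<^sup>2)"
proof -
  let ?\<Omega> = "hartogs_triangle (1 / real k)"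
  define g where "g w = indicator ?\<Omega> w *\<^sub>R (norm (f w))\<^sup>2" for w
  have "integrable lborel g"
    using f by (simp add: bergman_space_def set_integrable_def g_def[abs_def])
  then have int: "integrable (lborel \<Otimes>\<^sub>M lborel) (\<lambda>p. g (vec_of_base_fibre p))"
    by (subst integrable_vec_of_base_fibre_iff) auto
  have gJ: "g (vec_of_base_fibre (b, a)) = indicator (ball 0 (norm b ^ k)) a *\<^sub>R
      (indicator (ball 0 1 - {0}) b *\<^sub>R (norm (f (vec_of_base_fibre (b, a))))\<^sup>2)" for b a
    using vec_of_base_fibre_mem_hartogs_triangle_iff[OF k, of b a]
    by (auto simp: g_def split: split_indicator)
  from lborel_pair.integrable_fst'[OF int] show "integrable lborel G"
    by (simp only: G_def set_lebesgue_integral_def gJ)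
  from lborel_pair.AE_integrable_fst'[OF int]
  show "AE b in lborel. b \<in> ball 0 1 - {0} \<longrightarrow>
      set_integrable lborel (ball 0 (norm b ^ k)) (\<lambda>a. (norm (f (vec_of_base_fibre (b, a))))\<^sup>2)"
    unfolding gJ
    by eventually_elim (intro impI, simp only: set_integrable_def indicator_simps(1) scaleR_one)
qed

text \<open>Integration over a fibre evaluates \<open>f\<close> on the curve \<open>b \<mapsto> (u b^k, b)\<close> through \<open>z\<close>, where
  \<open>u = z1 / z2^k\<close>; the function \<open>h\<close> is \<open>f\<close> along this curve times the Jacobian factor. The curve keeps
  a fixed relative distance \<open>1 - |u|\<close> from the boundary of the fibres, and this is what makes \<open>h\<close>
  square integrable.\<close>

lemma hartogs_kernel_reproducing:
  assumes k: "k > 0" and f: "f \<in> bergman_space (hartogs_triangle (1 / real k))"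
    and z: "z \<in> hartogs_triangle (1 / real k)"
  shows "(LINT w:hartogs_triangle (1 / real k)|lborel. hartogs_kernel k z w * f w) = f z"
proof -
  let ?\<Omega> = "hartogs_triangle (1 / real k)"
  let ?D = "ball (0::complex) 1 - {0}"
  let ?J = vec_of_base_fibre
  note mem = vec_of_base_fibre_mem_hartogs_triangle_iff[OF k]
  have holf: "holomorphic_Cn f ?\<Omega>" using f by (simp add: bergman_space_def)
  have z2: "z $ 2 \<noteq> 0" by (rule hartogs_triangle_nonzero[OF k z])
  define u where "u = z $ 1 / z $ 2 ^ k"
  have u: "norm u < 1"
    using z z2 by (simp add: u_def mem_hartogs_triangle_iff[OF k] norm_divide norm_power)
  have ub: "norm (u * b ^ k) < norm b ^ k" if "b \<in> ?D" for b
    using u that by (simp add: norm_mult norm_power)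
  define h where "h b = (b / z $ 2) ^ k * f (?J (b, u * b ^ k))" for b
  have holh: "h holomorphic_on ?D"
    unfolding h_def using z2
    by (intro holomorphic_intros holomorphic_Cn_compose_curve[OF holf]) (auto simp: mem intro: ub)
  have holfib: "(\<lambda>a. f (?J (b, a))) holomorphic_on ball 0 (norm b ^ k)" if "b \<in> ?D" for b
    using that by (intro holomorphic_Cn_compose_curve[OF holf] holomorphic_intros) (auto simp: mem)
  note fib = bergman_space_hartogs_triangle_integrable[OF k f]
  define G where "G b = (LINT a:ball 0 (norm b ^ k)|lborel. indicator ?D b *\<^sub>R (norm (f (?J (b, a))))\<^sup>2)" for b
  \<comment> \<open>The mean value inequality is used on the disc about \<open>u b^k\<close> with radius \<open>r = (1 - |u|) |b|^k\<close>; the power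
    \<open>|b|^(2 k)\<close> in its area is absorbed by the factor \<open>(b / z2)^k\<close> of \<open>h\<close>, and \<open>C\<close> is the constant left over.\<close>
  define C where "C = pi * (1 - norm u)\<^sup>2 * norm (z $ 2) ^ (2 * k)"
  have C: "C > 0" using u z2 by (simp add: C_def)
  have hbound: "(norm (h b))\<^sup>2 \<le> G b / C"
    if b: "b \<in> ?D" and int: "set_integrable lborel (ball 0 (norm b ^ k)) (\<lambda>a. (norm (f (?J (b, a))))\<^sup>2)" for b
  proof -
    define r where "r = (1 - norm u) * norm b ^ k"
    have sub: "ball (u * b ^ k) r \<subseteq> ball 0 (norm b ^ k)"
    proof
      fix a assume "a \<in> ball (u * b ^ k) r"
      then have "norm (a - u * b ^ k) < r" by (simp add: dist_norm norm_minus_commute)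
      moreover have "norm a \<le> norm (a - u * b ^ k) + norm (u * b ^ k)"
        using norm_triangle_ineq[of "a - u * b ^ k" "u * b ^ k"] by simp
      ultimately show "a \<in> ball 0 (norm b ^ k)"
        by (simp add: r_def norm_mult norm_power algebra_simps)
    qed
    have "r > 0" using u b by (simp add: r_def)
    then have "pi * r\<^sup>2 * (norm (f (?J (b, u * b ^ k))))\<^sup>2 \<le> (LINT a:ball 0 (norm b ^ k)|lborel. (norm (f (?J (b, a))))\<^sup>2)"
      using holfib[OF b] int sub
      by (intro norm_square_le_disc_integral[where c = "u * b ^ k"]) (auto intro: holomorphic_on_subset)
    also have "\<dots> = G b" using b by (simp add: G_def)
    also have "pi * r\<^sup>2 * (norm (f (?J (b, u * b ^ k))))\<^sup>2 = C * (norm (h b))\<^sup>2"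
      using z2 by (simp add: C_def h_def r_def norm_mult norm_power norm_divide power_mult_distrib
          power_divide flip: power_mult) (simp add: mult.commute)
    finally show ?thesis using C by (simp add: field_simps)
  qed
  have int2h: "set_integrable lborel ?D (\<lambda>b. (norm (h b))\<^sup>2)"
    unfolding set_integrable_def
  proof (rule Bochner_Integration.integrable_bound)
    show "integrable lborel (\<lambda>b. G b / C)"
      using fib(1) by (simp add: G_def[abs_def])
    have "(\<lambda>b. indicator ?D b *\<^sub>R (norm (h b))\<^sup>2) \<in> borel_measurable borel"
      by (intro borel_measurable_continuous_on_indicator continuous_on_power continuous_on_norm
            holomorphic_on_imp_continuous_on[OF holh]) simp
    then show "(\<lambda>b. indicator ?D b *\<^sub>R (norm (h b))\<^sup>2) \<in> borel_measurable lborel" by simp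
    show "AE b in lborel. norm (indicator ?D b *\<^sub>R (norm (h b))\<^sup>2) \<le> norm (G b / C)"
      using fib(2)
    proof eventually_elim
      case (elim b)
      show ?case
      proof (cases "b \<in> ?D")
        case True
        with elim have "(norm (h b))\<^sup>2 \<le> G b / C" by (intro hbound) auto
        also have "\<dots> \<le> norm (G b / C)" by (simp only: real_norm_def abs_ge_self)
        finally show ?thesis using True by (simp only: indicator_simps(1)) simp
      qed simp
    qed
  qed
  define F where "F w = indicator ?\<Omega> w *\<^sub>R (hartogs_kernel k z w * f w)" for w
  have intF: "integrable lborel F"
    using set_integrable_cnj_mult_of_bergman_space[OF open_hartogs_triangle[OF k] f
        cnj_hartogs_kernel_mem_bergman_space[OF k z]]
    by (simp add: set_integrable_def F_def[abs_def])
  then have intFJ: "integrable (lborel \<Otimes>\<^sub>M lborel) (\<lambda>p. F (?J p))"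
    by (subst integrable_vec_of_base_fibre_iff) auto
  have contq: "continuous_on ?D (\<lambda>b. h b / (1 - z $ 2 * cnj b)\<^sup>2)"
  proof (intro continuous_intros holomorphic_on_imp_continuous_on[OF holh] ballI)
    fix b assume "b \<in> ?D"
    then have "?J (b, 0) \<in> ?\<Omega>" by (simp add: mem)
    from hartogs_kernel_denominators_nonzero(2)[OF k z this]
    show "(1 - z $ 2 * cnj b)\<^sup>2 \<noteq> 0" by simp
  qed
  have inner: "(LINT a|lborel. F (?J (b, a))) =
      indicator ?D b *\<^sub>R (h b / (1 - z $ 2 * cnj b)\<^sup>2) / of_real pi"
    if int: "b \<in> ?D \<longrightarrow> set_integrable lborel (ball 0 (norm b ^ k)) (\<lambda>a. (norm (f (?J (b, a))))\<^sup>2)" for b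
  proof (cases "b \<in> ?D")
    case False
    then have "F (?J (b, a)) = 0" for a by (simp add: F_def mem)
    then show ?thesis using False by simp
  next
    case b: True
    let ?R = "norm b ^ k"
    let ?c = "(b / z $ 2) ^ k / (1 - z $ 2 * cnj b)\<^sup>2 / of_real pi ^ 2"
    have R: "?R > 0" using b by simp
    have intf: "set_integrable lborel (ball 0 ?R) (\<lambda>a. f (?J (b, a)))"
      using int b holfib[OF b]
      by (intro set_integrable_norm_square_imp_integrable holomorphic_on_imp_continuous_on) auto
    have "F (?J (b, a)) = ?c * (indicator (ball 0 ?R) a *\<^sub>R
        (f (?J (b, a)) * of_real ?R ^ 2 / (of_real ?R ^ 2 - (u * b ^ k) * cnj a)\<^sup>2))" for a
    proof (cases "a \<in> ball 0 ?R")
      case True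
      then have "?J (b, a) \<in> ?\<Omega>" using b by (simp add: mem)
      then show ?thesis
        using True hartogs_kernel_fibre[OF k z, of b a] by (simp add: F_def u_def)
    qed (simp add: F_def mem)
    then have "(LINT a|lborel. F (?J (b, a))) = ?c * (LINT a:ball 0 ?R|lborel.
        f (?J (b, a)) * of_real ?R ^ 2 / (of_real ?R ^ 2 - (u * b ^ k) * cnj a)\<^sup>2)"
      by (simp only: set_lebesgue_integral_def integral_mult_right_zero)
    also have "\<dots> = ?c * (of_real pi * f (?J (b, u * b ^ k)))"
      by (simp only: bergman_reproducing_disc[OF R holfib[OF b] intf ub[OF b]])
    also have "\<dots> = indicator ?D b *\<^sub>R (h b / (1 - z $ 2 * cnj b)\<^sup>2) / of_real pi"
      using b by (simp add: h_def power2_eq_square)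
    finally show ?thesis .
  qed
  have "(LINT w:?\<Omega>|lborel. hartogs_kernel k z w * f w) = (LINT w|lborel. F w)"
    by (simp add: F_def set_lebesgue_integral_def)
  also have "\<dots> = (LINT b|lborel. LINT a|lborel. F (?J (b, a)))"
    by (rule integral_fibrewise[OF intF, symmetric])
  also have "\<dots> = (LINT b|lborel. indicator ?D b *\<^sub>R (h b / (1 - z $ 2 * cnj b)\<^sup>2) / of_real pi)"
  proof (rule integral_cong_AE)
    show "(\<lambda>b. LINT a|lborel. F (?J (b, a))) \<in> borel_measurable lborel"
      using lborel_pair.integrable_fst'[OF intFJ] by (rule borel_measurable_integrable)
    have "(\<lambda>b. indicator ?D b *\<^sub>R (h b / (1 - z $ 2 * cnj b)\<^sup>2)) \<in> borel_measurable borel"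
      by (intro borel_measurable_continuous_on_indicator contq) simp
    then show "(\<lambda>b. indicator ?D b *\<^sub>R (h b / (1 - z $ 2 * cnj b)\<^sup>2) / of_real pi) \<in> borel_measurable lborel"
      by (intro borel_measurable_divide) simp_all
    show "AE b in lborel. (LINT a|lborel. F (?J (b, a))) =
        indicator ?D b *\<^sub>R (h b / (1 - z $ 2 * cnj b)\<^sup>2) / of_real pi"
      using fib(2) by eventually_elim (rule inner)
  qed
  also have "\<dots> = (LINT b:?D|lborel. h b / (1 - z $ 2 * cnj b)\<^sup>2) / of_real pi"
    by (simp only: set_lebesgue_integral_def integral_divide_zero)
  also have "(LINT b:?D|lborel. h b / (1 - z $ 2 * cnj b)\<^sup>2) = of_real pi * h (z $ 2)"
    using z z2 by (intro bergman_reproducing_punctured_disc holh int2h) (auto simp: mem_hartogs_triangle_iff[OF k])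
  also have "h (z $ 2) = f z"
    using z2 by (simp add: h_def u_def vec_of_base_fibre_eta)
  finally show ?thesis by simp
qed

lemma is_bergman_kernel_hartogs_kernel:
  assumes "k > 0"
  shows "is_bergman_kernel (hartogs_triangle (1 / real k)) (hartogs_kernel k)"
  using cnj_hartogs_kernel_mem_bergman_space[OF assms] hartogs_kernel_reproducing[OF assms]
  by (simp add: is_bergman_kernel_def)

theorem corollary4p1:
  fixes k :: nat
  assumes "k > 0"
  shows "lu_qi_keng (hartogs_triangle (1 / real k))"
proof -
  note eq = bergman_kernel_eqI[OF open_hartogs_triangle[OF assms] is_bergman_kernel_hartogs_kernel[OF assms]]
  show ?thesis
    unfolding lu_qi_keng_def
    using domain_Cn_hartogs_triangle[OF assms] hartogs_kernel_nonzero[OF assms] by (simp add: eq)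
qed

end
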